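(* Let $\{X_t : t=0,1,2,\dots\}$ be a homogeneous real-valued Markov chain with initial distribution $F_0$ and transition kernel $\pi$ satisfying Assumptions F$_0$, A1 and A2 (stated in full in the context), with associated $H_0,\sigma,a,b,K,a_s,b_s,\psi^a_s,\psi^b_s$ ($s=1,2,\dots$). Then, for every $t\in\{1,2,\dots\}$, as $u\uparrow\infty$, the conditional distribution of $$\left(\frac{X_0-u}{\sigma(u)},\frac{X_1-a_1(X_0)}{b_1(X_0)},\frac{X_2-a_2(X_0)}{b_2(X_0)},\dots,\frac{X_t-a_t(X_0)}{b_t(X_0)}\right)\quad\text{given } X_0>u$$ converges weakly (on $[0,\infty)\times\mathbb{R}^t$) to the distribution of $(E_0,M_1,M_2,\dots,M_t)$, where (i) $E_0\sim H_0$, and $E_0$ and the vector $(M_1,M_2,\dots,M_t)$ are independent; (ii) $M_1\sim K$ and $M_{s+1}=\psi^a_s(M_s)+\psi^b_s(M_s)\,\varepsilon_s$ for $s=1,2,\dots$, where $\varepsilon_1,\varepsilon_2,\dots$ is an i.i.d. sequence with $\varepsilon_s\sim K$, independent of $M_1$.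
   Context: Notation: $F_0(x)=\Pr(X_0\le x)$ and $\overline F_0=1-F_0$; $\pi(x,A)=\Pr(X_{t+1}\in A\mid X_t=x)$ for $x\in\mathbb{R}$ and Borel $A\subset\mathbb{R}$. For $\alpha\in\mathbb{R}$, $\beta>0$, $\pi(v,\alpha+\beta\,dx)$ denotes the law of $(Z-\alpha)/\beta$ when $Z\sim\pi(v,\cdot)$. $F_0(u+\sigma(u)dx)/\overline F_0(u)$, $x\ge 0$, denotes the conditional law of $(X_0-u)/\sigma(u)$ given $X_0>u$. Functions "converge uniformly on compact sets in the variable $x\in E$" if for every compact $C\subset E$ the supremum over $x\in C$ of the absolute difference to the limit tends to $0$. Assumption F$_0$: $F_0$ has upper endpoint $\infty$ and there exist a probability distribution $H_0$ on $[0,\infty)$ and a measurable function $\sigma(u)>0$ such that $F_0(u+\sigma(u)dx)/\overline F_0(u)$ converges weakly to $H_0(dx)$ as $u\uparrow\infty$. Assumption A1: There exist measurable functions $a(v)\in\mathbb{R}$, $b(v)>0$ and a non-degenerate probability distribution $K$ on $\mathbb{R}$ (no mass at $\pm\infty$) such that $\pi(v,a(v)+b(v)dx)$ converges weakly on $\mathbb{R}$ to $K(dx)$ as $v\uparrow\infty$. Assumption A2: (a) With $a_1=a$, $b_1=b$, there exist measurable functions $a_t(v)\in\mathbb{R}$, $b_t(v)>0$ for $t=2,3,\dots$ such that $a_t(v)+b_t(v)x\to\infty$ as $v\uparrow\infty$ for all $x\in\mathbb{R}$ and $t=1,2,\dots$. (b) There exist continuous functions $$\psi^a_t(x)=\lim_{v\to\infty}\frac{a(a_t(v)+b_t(v)x)-a_{t+1}(v)}{b_{t+1}(v)}\in\mathbb{R},\qquad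 \psi^b_t(x)=\lim_{v\to\infty}\frac{b(a_t(v)+b_t(v)x)}{b_{t+1}(v)}>0,$$ defined for $x\in\mathbb{R}$, $t=1,2,\dots$, such that the remainder terms $$r^a_t(v,x)=\frac{a_{t+1}(v)-a(a_t(v)+b_t(v)x)+b_{t+1}(v)\psi^a_t(x)}{b(a_t(v)+b_t(v)x)},\qquad r^b_t(v,x)=1-\frac{b_{t+1}(v)\psi^b_t(x)}{b(a_t(v)+b_t(v)x)}$$ converge to $0$ as $v\uparrow\infty$, both convergences holding uniformly on compact sets in the variable $x\in\mathbb{R}$. *)

theory Defs
  imports "HOL-Probability.Probability"
begin

text \<open>
  Weak convergence of probability measures carried by the topological space \<open>T\<close>, along a filter.
  The set integral is used because the measures may live on a larger ambient space
  (e.g. laws on the real line that are concentrated on the half-line).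
\<close>

definition weak_conv_on ::
  "'a topology \<Rightarrow> ('i \<Rightarrow> 'a measure) \<Rightarrow> 'a measure \<Rightarrow> 'i filter \<Rightarrow> bool" where
  "weak_conv_on T \<mu> \<nu> F \<longleftrightarrow>
     (\<forall>g. continuous_map T euclideanreal g \<and> bounded (g ` topspace T) \<longrightarrow>
        ((\<lambda>i. set_lebesgue_integral (\<mu> i) (topspace T) g) \<longlongrightarrow>
           set_lebesgue_integral \<nu> (topspace T) g) F)"

definition upper_endpoint :: "real measure \<Rightarrow> ereal" where
  "upper_endpoint F = (SUP x\<in>{x. cdf F x < 1}. ereal x)"

definition past :: "'w measure \<Rightarrow> (nat \<Rightarrow> 'w \<Rightarrow> real) \<Rightarrow> nat \<Rightarrow> 'w measure" where
  "past M X t =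
     vimage_algebra (space M) (\<lambda>\<omega>. \<lambda>i\<in>{..t}. X i \<omega>) (\<Pi>\<^sub>M i\<in>{..t}. (borel :: real measure))"

definition homogeneous_markov_chain ::
  "'w measure \<Rightarrow> (nat \<Rightarrow> 'w \<Rightarrow> real) \<Rightarrow> real measure \<Rightarrow> (real \<Rightarrow> real measure) \<Rightarrow> bool" where
  "homogeneous_markov_chain M X F\<^sub>0 \<pi> \<longleftrightarrow>
     prob_space M \<and>
     (\<forall>t. X t \<in> borel_measurable M) \<and>
     distr M borel (X 0) = F\<^sub>0 \<and>
     \<pi> \<in> borel \<rightarrow>\<^sub>M prob_algebra borel \<and>
     (\<forall>t. \<forall>A\<in>sets borel.
        AE \<omega> in M. real_cond_exp M (past M X t) (indicator (X (Suc t) -` A \<inter> space M)) \<omega>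
                      = measure (\<pi> (X t \<omega>)) A)"

definition assumption_F0 ::
  "real measure \<Rightarrow> real measure \<Rightarrow> (real \<Rightarrow> real) \<Rightarrow> bool" where
  "assumption_F0 F\<^sub>0 H\<^sub>0 \<sigma> \<longleftrightarrow>
     upper_endpoint F\<^sub>0 = \<infinity> \<and>
     real_distribution H\<^sub>0 \<and> measure H\<^sub>0 {0..} = 1 \<and>
     \<sigma> \<in> borel_measurable borel \<and> (\<forall>u. \<sigma> u > 0) \<and>
     weak_conv_on (top_of_set {0..})
       (\<lambda>u. distr (uniform_measure F\<^sub>0 {u<..}) borel (\<lambda>x. (x - u) / \<sigma> u)) H\<^sub>0 at_top"

definition assumption_A1 ::
  "(real \<Rightarrow> real measure) \<Rightarrow> (real \<Rightarrow> real) \<Rightarrow> (real \<Rightarrow> real) \<Rightarrow> real measure \<Rightarrow> bool" where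
  "assumption_A1 \<pi> a b K \<longleftrightarrow>
     a \<in> borel_measurable borel \<and> b \<in> borel_measurable borel \<and> (\<forall>v. b v > 0) \<and>
     real_distribution K \<and> (\<forall>c. K \<noteq> return borel c) \<and>
     weak_conv_on euclideanreal (\<lambda>v. distr (\<pi> v) borel (\<lambda>z. (z - a v) / b v)) K at_top"

text \<open>
  The norming functions \<open>a\<^sub>t\<close>, \<open>b\<^sub>t\<close> are \<open>as t\<close>, \<open>bs t\<close> with \<open>t \<ge> 1\<close>; index \<open>0\<close> is not used.
\<close>

definition assumption_A2a ::
  "(real \<Rightarrow> real) \<Rightarrow> (real \<Rightarrow> real) \<Rightarrow> (nat \<Rightarrow> real \<Rightarrow> real) \<Rightarrow> (nat \<Rightarrow> real \<Rightarrow> real) \<Rightarrow> bool" where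
  "assumption_A2a a b as bs \<longleftrightarrow>
     as 1 = a \<and> bs 1 = b \<and>
     (\<forall>t\<ge>2. as t \<in> borel_measurable borel \<and> bs t \<in> borel_measurable borel \<and> (\<forall>v. bs t v > 0)) \<and>
     (\<forall>t\<ge>1. \<forall>x. filterlim (\<lambda>v. as t v + bs t v * x) at_top at_top)"

definition remainder_a ::
  "(real \<Rightarrow> real) \<Rightarrow> (real \<Rightarrow> real) \<Rightarrow> (nat \<Rightarrow> real \<Rightarrow> real) \<Rightarrow> (nat \<Rightarrow> real \<Rightarrow> real) \<Rightarrow>
   (nat \<Rightarrow> real \<Rightarrow> real) \<Rightarrow> nat \<Rightarrow> real \<Rightarrow> real \<Rightarrow> real" where
  "remainder_a a b as bs \<psi>a t v x =
     (as (t + 1) v - a (as t v + bs t v * x) + bs (t + 1) v * \<psi>a t x) / b (as t v + bs t v * x)"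

definition remainder_b ::
  "(real \<Rightarrow> real) \<Rightarrow> (nat \<Rightarrow> real \<Rightarrow> real) \<Rightarrow> (nat \<Rightarrow> real \<Rightarrow> real) \<Rightarrow>
   (nat \<Rightarrow> real \<Rightarrow> real) \<Rightarrow> nat \<Rightarrow> real \<Rightarrow> real \<Rightarrow> real" where
  "remainder_b b as bs \<psi>b t v x =
     1 - bs (t + 1) v * \<psi>b t x / b (as t v + bs t v * x)"

definition assumption_A2b ::
  "(real \<Rightarrow> real) \<Rightarrow> (real \<Rightarrow> real) \<Rightarrow> (nat \<Rightarrow> real \<Rightarrow> real) \<Rightarrow> (nat \<Rightarrow> real \<Rightarrow> real) \<Rightarrow>
   (nat \<Rightarrow> real \<Rightarrow> real) \<Rightarrow> (nat \<Rightarrow> real \<Rightarrow> real) \<Rightarrow> bool" where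
  "assumption_A2b a b as bs \<psi>a \<psi>b \<longleftrightarrow>
     (\<forall>t\<ge>1.
        continuous_on UNIV (\<psi>a t) \<and> continuous_on UNIV (\<psi>b t) \<and>
        (\<forall>x. ((\<lambda>v. (a (as t v + bs t v * x) - as (t + 1) v) / bs (t + 1) v) \<longlongrightarrow> \<psi>a t x) at_top) \<and>
        (\<forall>x. ((\<lambda>v. b (as t v + bs t v * x) / bs (t + 1) v) \<longlongrightarrow> \<psi>b t x) at_top) \<and>
        (\<forall>x. \<psi>b t x > 0) \<and>
        (\<forall>C. compact C \<longrightarrow> uniform_limit C (remainder_a a b as bs \<psi>a t) (\<lambda>x. 0) at_top) \<and>
        (\<forall>C. compact C \<longrightarrow> uniform_limit C (remainder_b b as bs \<psi>b t) (\<lambda>x. 0) at_top))"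

text \<open>
  This is \<^const>\<open>prob_space.indep_var\<close> for two variables whose values have different types.
\<close>

definition indep_rv ::
  "'n measure \<Rightarrow> 'b measure \<Rightarrow> ('n \<Rightarrow> 'b) \<Rightarrow> 'c measure \<Rightarrow> ('n \<Rightarrow> 'c) \<Rightarrow> bool" where
  "indep_rv N S U T V \<longleftrightarrow>
     U \<in> N \<rightarrow>\<^sub>M S \<and> V \<in> N \<rightarrow>\<^sub>M T \<and>
     prob_space.indep_set N {U -` A \<inter> space N | A. A \<in> sets S} {V -` A \<inter> space N | A. A \<in> sets T}"

text \<open>
  The hidden tail chain \<open>M\<^sub>1, M\<^sub>2, \<dots>\<close> is \<open>Y 1, Y 2, \<dots>\<close> and its innovations are
  \<open>\<epsilon> 1, \<epsilon> 2, \<dots>\<close>; index \<open>0\<close> is not used.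
\<close>

definition hidden_tail_chain ::
  "'n measure \<Rightarrow> real measure \<Rightarrow> (nat \<Rightarrow> real \<Rightarrow> real) \<Rightarrow> (nat \<Rightarrow> real \<Rightarrow> real) \<Rightarrow>
   (nat \<Rightarrow> 'n \<Rightarrow> real) \<Rightarrow> (nat \<Rightarrow> 'n \<Rightarrow> real) \<Rightarrow> bool" where
  "hidden_tail_chain N K \<psi>a \<psi>b Y \<epsilon> \<longleftrightarrow>
     prob_space N \<and>
     (\<forall>s\<ge>1. Y s \<in> borel_measurable N) \<and>
     distr N borel (Y 1) = K \<and>
     (\<forall>s\<ge>1. \<forall>\<omega>\<in>space N. Y (s + 1) \<omega> = \<psi>a s (Y s \<omega>) + \<psi>b s (Y s \<omega>) * \<epsilon> s \<omega>) \<and>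
     prob_space.indep_vars N (\<lambda>_. borel) \<epsilon> {1..} \<and>
     (\<forall>s\<ge>1. distr N borel (\<epsilon> s) = K) \<and>
     indep_rv N
       borel (Y 1)
       (\<Pi>\<^sub>M s\<in>{1..}. borel) (\<lambda>\<omega>. \<lambda>s\<in>{1..}. \<epsilon> s \<omega>)"

text \<open>Points of \<open>[0,\<infinity>) \<times> \<real>\<^sup>t\<close> are extensional functions on \<open>{..t}\<close>.\<close>

definition half_space :: "nat \<Rightarrow> (nat \<Rightarrow> real) topology" where
  "half_space t =
     product_topology (\<lambda>i. if i = 0 then top_of_set {0..} else euclideanreal) {..t}"

definition normalized_chain ::
  "(nat \<Rightarrow> 'w \<Rightarrow> real) \<Rightarrow> (real \<Rightarrow> real) \<Rightarrow> (nat \<Rightarrow> real \<Rightarrow> real) \<Rightarrow> (nat \<Rightarrow> real \<Rightarrow> real) \<Rightarrow>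
   nat \<Rightarrow> real \<Rightarrow> 'w \<Rightarrow> (nat \<Rightarrow> real)" where
  "normalized_chain X \<sigma> as bs t u \<omega> =
     (\<lambda>i\<in>{..t}. if i = 0 then (X 0 \<omega> - u) / \<sigma> u
                else (X i \<omega> - as i (X 0 \<omega>)) / bs i (X 0 \<omega>))"

lemma (in prob_space) indep_rvI:
  assumes "indep_var S U T V" "f \<in> S \<rightarrow>\<^sub>M S'" "g \<in> T \<rightarrow>\<^sub>M T'"
  shows "indep_rv M S' (\<lambda>\<omega>. f (U \<omega>)) T' (\<lambda>\<omega>. g (V \<omega>))"
proof -
  from assms(1) have U: "U \<in> M \<rightarrow>\<^sub>M S" and V: "V \<in> M \<rightarrow>\<^sub>M T"
    and ind: "indep_set (sigma_sets (space M) {U -` A \<inter> space M | A. A \<in> sets S})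
      (sigma_sets (space M) {V -` A \<inter> space M | A. A \<in> sets T})"
    by (auto simp: indep_var_eq)
  have fU: "(\<lambda>\<omega>. f (U \<omega>)) \<in> M \<rightarrow>\<^sub>M S'" using measurable_compose[OF U assms(2)] .
  have gV: "(\<lambda>\<omega>. g (V \<omega>)) \<in> M \<rightarrow>\<^sub>M T'" using measurable_compose[OF V assms(3)] .
  have "indep_set {(\<lambda>\<omega>. f (U \<omega>)) -` A \<inter> space M | A. A \<in> sets S'}
     {(\<lambda>\<omega>. g (V \<omega>)) -` A \<inter> space M | A. A \<in> sets T'}"
  proof (rule indep_setI)
    show "{(\<lambda>\<omega>. f (U \<omega>)) -` A \<inter> space M | A. A \<in> sets S'} \<subseteq> events"
      using measurable_sets[OF fU] by auto
    show "{(\<lambda>\<omega>. g (V \<omega>)) -` A \<inter> space M | A. A \<in> sets T'} \<subseteq> events"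
      using measurable_sets[OF gV] by auto
    fix a b assume "a \<in> {(\<lambda>\<omega>. f (U \<omega>)) -` A \<inter> space M | A. A \<in> sets S'}"
      "b \<in> {(\<lambda>\<omega>. g (V \<omega>)) -` A \<inter> space M | A. A \<in> sets T'}"
    then obtain A B where A: "A \<in> sets S'" and B: "B \<in> sets T'"
      and a: "a = (\<lambda>\<omega>. f (U \<omega>)) -` A \<inter> space M" and b: "b = (\<lambda>\<omega>. g (V \<omega>)) -` B \<inter> space M" by auto
    have "a = U -` (f -` A \<inter> space S) \<inter> space M" using a measurable_space[OF U] by auto
    moreover have "b = V -` (g -` B \<inter> space T) \<inter> space M" using b measurable_space[OF V] by auto
    moreover have "f -` A \<inter> space S \<in> sets S" "g -` B \<inter> space T \<in> sets T"
      using A B assms by auto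
    ultimately show "prob (a \<inter> b) = prob a * prob b"
      by (intro indep_setD[OF ind] sigma_sets.Basic) blast+
  qed
  with fU gV show ?thesis by (simp add: indep_rv_def)
qed

text \<open>
  A hidden tail chain together with an independent variable of law \<open>H\<^sub>0\<close> always exists, so requirements
  on such a family are never vacuous (on the sample space of real sequences).
\<close>

lemma hidden_tail_chain_exists:
  assumes "real_distribution H\<^sub>0" "real_distribution K"
    and meas: "\<And>s. s \<ge> 1 \<Longrightarrow> \<psi>a s \<in> borel_measurable borel" "\<And>s. s \<ge> 1 \<Longrightarrow> \<psi>b s \<in> borel_measurable borel"
  shows "\<exists>(N :: (nat \<Rightarrow> real) measure) E\<^sub>0 Y \<epsilon>.
    hidden_tail_chain N K \<psi>a \<psi>b Y \<epsilon> \<and>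
    E\<^sub>0 \<in> borel_measurable N \<and> distr N borel E\<^sub>0 = H\<^sub>0 \<and>
    (\<forall>t. indep_rv N borel E\<^sub>0 (\<Pi>\<^sub>M s\<in>{1..t}. borel) (\<lambda>\<omega>. \<lambda>s\<in>{1..t}. Y s \<omega>))"
proof -
  interpret H: real_distribution H\<^sub>0 by fact
  interpret K: real_distribution K by fact
  define D where "D i = (if i = 0 then H\<^sub>0 else K)" for i :: nat
  define N where "N = PiM UNIV D"
  have D: "prob_space (D i)" and sD: "sets (D i) = sets borel" for i
    by (auto simp: D_def H.prob_space_axioms K.prob_space_axioms)
  have sN: "sets N = sets (PiM UNIV (\<lambda>_. borel))"
    unfolding N_def by (intro sets_PiM_cong) (auto simp: sD)
  interpret N: prob_space N unfolding N_def by (intro prob_space_PiM D)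
  have spN: "space N = UNIV" using sets_eq_imp_space_eq[OF sN] by (simp add: space_PiM)
  have [measurable]: "(\<lambda>\<omega>. \<omega> i) \<in> borel_measurable N" for i
    by (subst measurable_cong_sets[OF sN refl]) simp
  have dist: "distr N borel (\<lambda>\<omega>. \<omega> i) = D i" for i
  proof -
    have "distr N borel (\<lambda>\<omega>. \<omega> i) = distr N (D i) (\<lambda>\<omega>. \<omega> i)"
      by (intro distr_cong) (auto simp: sD)
    then show ?thesis unfolding N_def using distr_PiM_component[of UNIV D i] D by simp
  qed
  have ind: "N.indep_vars (\<lambda>_. borel) (\<lambda>i \<omega>. \<omega> i) UNIV"
  proof (subst N.indep_vars_iff_distr_eq_PiM)
    show "distr N (Pi\<^sub>M UNIV (\<lambda>_. borel)) (\<lambda>x. \<lambda>i\<in>UNIV. x i) =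
      Pi\<^sub>M UNIV (\<lambda>i. distr N borel (\<lambda>\<omega>. \<omega> i))"
      unfolding dist restrict_UNIV using sN by (simp add: distr_id2 N_def[symmetric])
  qed auto
  define Y0 where "Y0 = rec_nat (\<lambda>\<omega>. \<omega> (Suc 0))
    (\<lambda>n f \<omega>. \<psi>a (Suc n) (f \<omega>) + \<psi>b (Suc n) (f \<omega>) * (\<omega> (Suc (Suc n)) :: real))"
  define Y where "Y s = Y0 (s - 1)" for s
  have Y0: "Y0 0 = (\<lambda>\<omega>. \<omega> (Suc 0))" "Y0 (Suc n) = (\<lambda>\<omega>. \<psi>a (Suc n) (Y0 n \<omega>) + \<psi>b (Suc n) (Y0 n \<omega>) * \<omega> (Suc (Suc n)))" for n
    by (auto simp: Y0_def)
  define \<epsilon> where "\<epsilon> s \<omega> = \<omega> (Suc s)" for s and \<omega> :: "nat \<Rightarrow> real"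
  have Y0m: "Y0 n \<in> borel_measurable (PiM {1..} (\<lambda>_. borel))" for n
  proof (induction n)
    case 0 show ?case unfolding Y0 by (rule measurable_component_singleton) simp
  next
    case (Suc n)
    note Suc[measurable]
    note meas[of "Suc n", simplified, measurable]
    have [measurable]: "(\<lambda>\<omega>. \<omega> (Suc (Suc n))) \<in> borel_measurable (PiM {1..} (\<lambda>_. borel))"
      by (rule measurable_component_singleton) simp
    show ?case unfolding Y0 by measurable
  qed
  have restr: "(\<lambda>\<omega>. restrict \<omega> {1..}) \<in> N \<rightarrow>\<^sub>M PiM {1..} (\<lambda>_. borel)"
    by (rule measurable_restrict) simp
  have Y0r: "Y0 n \<omega> = Y0 n (restrict \<omega> {1..})" for n \<omega>
    by (induction n) (auto simp: Y0)
  have Ym: "Y s \<in> borel_measurable N" for s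
    unfolding Y_def using measurable_compose[OF restr Y0m[of "s - 1"]]
    by (simp only: Y0r[symmetric])
  have indE: "indep_rv N borel (\<lambda>\<omega>. \<omega> 0) (\<Pi>\<^sub>M s\<in>{1..t}. borel) (\<lambda>\<omega>. \<lambda>s\<in>{1..t}. Y s \<omega>)" for t
  proof -
    have "(\<lambda>\<omega>. \<lambda>s\<in>{1..t}. Y s \<omega>) = (\<lambda>\<omega>. (\<lambda>\<omega>. \<lambda>s\<in>{1..t}. Y s \<omega>) (restrict \<omega> {1..}))"
      unfolding Y_def by (subst Y0r) simp
    moreover have "(\<lambda>\<omega>. \<omega> 0) = (\<lambda>\<omega>. (\<lambda>\<omega>. \<omega> 0) (restrict \<omega> {0::nat}))" by auto
    moreover have "indep_rv N borel (\<lambda>\<omega>. (\<lambda>\<omega>. \<omega> 0) (restrict \<omega> {0}))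
       (\<Pi>\<^sub>M s\<in>{1..t}. borel) (\<lambda>\<omega>. (\<lambda>\<omega>. \<lambda>s\<in>{1..t}. Y s \<omega>) (restrict \<omega> {1..}))"
    proof (rule N.indep_rvI[where f = "\<lambda>\<omega>. \<omega> 0" and g = "\<lambda>\<omega>. \<lambda>s\<in>{1..t}. Y s \<omega>"
        and U = "\<lambda>\<omega>. restrict \<omega> {0}" and V = "\<lambda>\<omega>. restrict \<omega> {1..}"])
      show "N.indep_var (PiM {0} (\<lambda>_. borel)) (\<lambda>\<omega>. restrict \<omega> {0}) (PiM {1..} (\<lambda>_. borel)) (\<lambda>\<omega>. restrict \<omega> {1..})"
        using N.indep_var_restrict[OF ind, of "{0}" "{1..}"] by auto
      show "(\<lambda>\<omega>. \<omega> 0) \<in> PiM {0::nat} (\<lambda>_. borel) \<rightarrow>\<^sub>M (borel :: real measure)" by simp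
      show "(\<lambda>\<omega>. \<lambda>s\<in>{1..t}. Y s \<omega>) \<in> PiM {1..} (\<lambda>_. borel) \<rightarrow>\<^sub>M PiM {1..t} (\<lambda>_. borel)"
        unfolding Y_def by (intro measurable_restrict Y0m)
    qed
    ultimately show ?thesis by simp
  qed
  have indeps: "N.indep_vars (\<lambda>_. borel) \<epsilon> {1..}"
  proof -
    have "N.indep_vars (\<lambda>j. PiM {Suc j} (\<lambda>_. borel)) (\<lambda>j \<omega>. restrict (\<lambda>i. \<omega> i) {Suc j}) {1..}"
      by (rule N.indep_vars_restrict[OF ind]) (auto simp: disjoint_family_on_def)
    from N.indep_vars_compose2[OF this, of "\<lambda>j f. f (Suc j)" "\<lambda>_. borel"]
    show ?thesis by (simp add: \<epsilon>_def[abs_def])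
  qed
  have indY: "indep_rv N borel (Y 1) (\<Pi>\<^sub>M s\<in>{1..}. borel) (\<lambda>\<omega>. \<lambda>s\<in>{1..}. \<epsilon> s \<omega>)"
  proof -
    have "(\<lambda>\<omega>. \<lambda>s\<in>{1..}. \<epsilon> s \<omega>) = (\<lambda>\<omega>. (\<lambda>\<omega>. \<lambda>s\<in>{1..}. \<epsilon> s \<omega>) (restrict \<omega> {2..}))"
      unfolding \<epsilon>_def by (auto simp: fun_eq_iff)
    moreover have "Y 1 = (\<lambda>\<omega>. (\<lambda>\<omega>. \<omega> (Suc 0)) (restrict \<omega> {Suc 0}))" by (auto simp: Y_def Y0)
    moreover have "indep_rv N borel (\<lambda>\<omega>. (\<lambda>\<omega>. \<omega> (Suc 0)) (restrict \<omega> {Suc 0}))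
       (\<Pi>\<^sub>M s\<in>{1..}. borel) (\<lambda>\<omega>. (\<lambda>\<omega>. \<lambda>s\<in>{1..}. \<epsilon> s \<omega>) (restrict \<omega> {2..}))"
    proof (rule N.indep_rvI[where f = "\<lambda>\<omega>. \<omega> (Suc 0)" and g = "\<lambda>\<omega>. \<lambda>s\<in>{1..}. \<epsilon> s \<omega>"
        and U = "\<lambda>\<omega>. restrict \<omega> {Suc 0}" and V = "\<lambda>\<omega>. restrict \<omega> {2..}"])
      show "N.indep_var (PiM {Suc 0} (\<lambda>_. borel)) (\<lambda>\<omega>. restrict \<omega> {Suc 0}) (PiM {2..} (\<lambda>_. borel)) (\<lambda>\<omega>. restrict \<omega> {2..})"
        using N.indep_var_restrict[OF ind, of "{Suc 0}" "{2..}"] by auto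
      show "(\<lambda>\<omega>. \<omega> (Suc 0)) \<in> PiM {Suc 0} (\<lambda>_. borel) \<rightarrow>\<^sub>M (borel :: real measure)" by simp
      show "(\<lambda>\<omega>. \<lambda>s\<in>{1..}. \<epsilon> s \<omega>) \<in> PiM {2..} (\<lambda>_. borel) \<rightarrow>\<^sub>M PiM {1..} (\<lambda>_. borel)"
        unfolding \<epsilon>_def by (intro measurable_restrict measurable_component_singleton) auto
    qed
    ultimately show ?thesis by simp
  qed
  have rec: "Y (s + 1) \<omega> = \<psi>a s (Y s \<omega>) + \<psi>b s (Y s \<omega>) * \<epsilon> s \<omega>" if "s \<ge> 1" for s \<omega>
    using that by (cases s) (auto simp: Y_def Y0 \<epsilon>_def)
  have "hidden_tail_chain N K \<psi>a \<psi>b Y \<epsilon>"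
    unfolding hidden_tail_chain_def
    using N.prob_space_axioms Ym rec indeps indY dist[of "Suc 0"] dist[of "Suc s" for s]
    by (auto simp: Y_def Y0 \<epsilon>_def[abs_def] D_def)
  moreover have "distr N borel (\<lambda>\<omega>. \<omega> 0) = H\<^sub>0" using dist[of 0] by (simp add: D_def)
  ultimately show ?thesis using indE by (intro exI[of _ N] exI conjI) auto
qed

end

theory Submission
  imports Defs
begin

text \<open>
  The proof is a coupling by quantile transforms. Let \<open>Q\<^sub>w\<close> be the quantile function of the normalised
  kernel \<open>\<pi>(w, a(w) + b(w) dx)\<close> and \<open>\<omega>\<^sub>0, \<omega>\<^sub>1, \<dots>\<close> independent uniform variables. Given \<open>X\<^sub>0 > u\<close>, the chain has
  the law of the path that starts in \<open>u + \<sigma>(u) q\<^sub>u(\<omega>\<^sub>0)\<close>, where \<open>q\<^sub>u\<close> is the quantile function of the normalised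
  exceedances, and moves from \<open>w\<close> to \<open>a(w) + b(w) Q\<^sub>w(\<omega>\<^sub>s)\<close>. Weak convergence on the line makes quantile
  functions converge at every continuity point of the limit, and that exceptional set is countable and
  does not depend on \<open>w\<close>. Since all states of the path tend to infinity with \<open>u\<close>, Assumption A2 turns this,
  one step at a time, into almost sure convergence of the normalised path to the hidden tail chain
  driven by the same \<open>\<omega>\<^sub>s\<close>, and dominated convergence concludes.
\<close>

section \<open>Quantile functions\<close>

text \<open>The left-continuous generalised inverse of the distribution function. Only levels
  strictly between 0 and 1 matter; there the set is nonempty and bounded below.\<close>

definition quantile :: "real measure \<Rightarrow> real \<Rightarrow> real" where
  "quantile \<mu> \<omega> = Inf {x. \<omega> \<le> cdf \<mu> x}"

abbreviation uniform01 :: "real measure" where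
  "uniform01 \<equiv> restrict_space lborel {0<..<1}"

lemma space_uniform01 [simp]: "space uniform01 = {0<..<1}"
  by (simp add: space_restrict_space)

lemma prob_space_uniform01: "prob_space uniform01"
  by (auto simp: space_restrict_space emeasure_restrict_space intro!: prob_spaceI)

text \<open>Right-continuity of \<open>cdf \<mu>\<close> makes the infimum attained. This Galois
  connection turns every question about quantiles below into one about distribution
  functions.\<close>

lemma quantile_le_iff:
  assumes "real_distribution \<mu>" "0 < \<omega>" "\<omega> < 1"
  shows "quantile \<mu> \<omega> \<le> x \<longleftrightarrow> \<omega> \<le> cdf \<mu> x"
proof -
  interpret cdf_distribution \<mu> using assms(1) by (simp add: cdf_distribution_def)
  show ?thesis using pseudoinverse[of \<omega> x] assms by (simp add: quantile_def)
qed

lemma measurable_quantile [measurable]: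
  assumes "real_distribution \<mu>"
  shows "quantile \<mu> \<in> uniform01 \<rightarrow>\<^sub>M borel"
proof -
  interpret cdf_distribution \<mu> using assms(1) by (simp add: cdf_distribution_def)
  have "quantile \<mu> \<in> borel_measurable (restrict_space borel {0<..<1})"
    using measurable_CI by (simp add: quantile_def[abs_def])
  moreover have "sets uniform01 = sets (restrict_space borel {0<..<1::real})"
    by (intro sets_restrict_space_cong) simp
  ultimately show ?thesis using measurable_cong_sets by blast
qed

text \<open>Inverse transform sampling: the levels whose quantile is at most \<open>x\<close> form
  an interval of length \<open>cdf \<mu> x\<close>.\<close>

lemma distr_quantile:
  assumes "real_distribution \<mu>"
  shows "distr uniform01 borel (quantile \<mu>) = \<mu>"
proof -
  interpret cdf_distribution \<mu> using assms(1) by (simp add: cdf_distribution_def)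
  show ?thesis using distr_I_eq_M by (simp add: quantile_def[abs_def])
qed

text \<open>A monotone function has only countably many discontinuities, and countable sets are
  Lebesgue null.\<close>

lemma AE_isCont_quantile:
  assumes "real_distribution \<mu>"
  shows "AE \<omega> in uniform01. isCont (quantile \<mu>) \<omega>"
proof -
  interpret cdf_distribution \<mu> using assms(1) by (simp add: cdf_distribution_def)
  let ?D = "{\<omega>\<in>{0<..<1}. \<not> isCont (quantile \<mu>) \<omega>}"
  have "mono_on {0<..<1} (quantile \<mu>)"
    using mono_I by (simp add: quantile_def[abs_def])
  then have D_countable: "countable ?D"
    using mono_on_ctble_discont[of "{0<..<1}" "quantile \<mu>"]
    by (simp add: at_within_open[of _ "{0 <..< 1}"] cong: conj_cong)
  then have "emeasure uniform01 ?D = 0"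
    using emeasure_lborel_countable[OF D_countable]
    by (subst emeasure_restrict_space) auto
  then show ?thesis
    by (rule AE_I[rotated]) (auto simp: sets_restrict_space_iff sets.countable D_countable)
qed

text \<open>Each of the two bounds passes through a point \<open>x\<close> that is not an atom of
  \<open>\<nu>\<close>. Atoms are countable, so every nonempty open interval contains such a point.
  A strict inequality between the level and \<open>cdf \<nu> x\<close> then persists along the
  filter.\<close>

lemma quantile_tendsto:
  assumes \<mu>: "\<And>i. real_distribution (\<mu> i)" and \<nu>: "real_distribution \<nu>"
    and conv: "\<And>x. measure \<nu> {x} = 0 \<Longrightarrow> ((\<lambda>i. cdf (\<mu> i) x) \<longlongrightarrow> cdf \<nu> x) F"
    and \<omega>: "0 < \<omega>" "\<omega> < 1" "isCont (quantile \<nu>) \<omega>"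
  shows "((\<lambda>i. quantile (\<mu> i) \<omega>) \<longlongrightarrow> quantile \<nu> \<omega>) F"
proof (rule order_tendstoI)
  interpret \<nu>: real_distribution \<nu> by fact
  fix r assume "r < quantile \<nu> \<omega>"
  then obtain x where x: "r < x" "x < quantile \<nu> \<omega>" "measure \<nu> {x} = 0"
    using open_minus_countable[OF \<nu>.countable_support, of "{r<..<quantile \<nu> \<omega>}"] by auto
  then have "cdf \<nu> x < \<omega>" using quantile_le_iff[OF \<nu> \<omega>(1,2)] by (metis not_le)
  from order_tendstoD(2)[OF conv[OF x(3)] this]
  show "\<forall>\<^sub>F i in F. r < quantile (\<mu> i) \<omega>"
  proof eventually_elim
    case (elim i)
    then have "x < quantile (\<mu> i) \<omega>" using quantile_le_iff[OF \<mu> \<omega>(1,2)] by (metis not_le)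
    with x(1) show ?case by simp
  qed
next
  interpret \<nu>: real_distribution \<nu> by fact
  fix r assume r: "quantile \<nu> \<omega> < r"
  have "(quantile \<nu> \<longlongrightarrow> quantile \<nu> \<omega>) (at_right \<omega>)"
    using \<omega>(3) by (auto simp: isCont_def intro: tendsto_within_subset)
  \<comment> \<open>The upper bound needs a strict inequality, but the Galois connection gives only
    a weak one. Continuity at \<open>\<omega>\<close> allows a slightly larger level
    \<open>w\<close> whose quantile is still below \<open>r\<close>; then
    \<open>w \<le> cdf \<nu> x\<close> yields \<open>\<omega> < cdf \<nu> x\<close>.\<close>
  from order_tendstoD(2)[OF this r] have "\<forall>\<^sub>F w in at_right \<omega>. quantile \<nu> w < r \<and> \<omega> < w \<and> w < 1"
    using eventually_at_right_less[of \<omega>] eventually_at_right_real[OF \<omega>(2)]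
    by eventually_elim auto
  then obtain w where w: "quantile \<nu> w < r" "\<omega> < w" "w < 1"
    using eventually_happens'[OF trivial_limit_at_right_real] by blast
  then obtain x where x: "quantile \<nu> w < x" "x < r" "measure \<nu> {x} = 0"
    using open_minus_countable[OF \<nu>.countable_support, of "{quantile \<nu> w<..<r}"] by auto
  have "w \<le> cdf \<nu> x" using quantile_le_iff[OF \<nu>, of w x] w x \<omega> by auto
  with w have "\<omega> < cdf \<nu> x" by simp
  from order_tendstoD(1)[OF conv[OF x(3)] this]
  show "\<forall>\<^sub>F i in F. quantile (\<mu> i) \<omega> < r"
  proof eventually_elim
    case (elim i)
    then have "quantile (\<mu> i) \<omega> \<le> x" using quantile_le_iff[OF \<mu> \<omega>(1,2)] by simp
    with x(2) show ?case by simp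
  qed
qed

text \<open>A limit at infinity can be tested along sequences tending to infinity. For a sequence of
  laws, convergence of integrals of bounded continuous functions implies convergence of distribution
  functions at continuity points, and non-atoms are such points.\<close>

lemma weak_conv_on_cdf_tendsto:
  assumes \<mu>: "\<And>v. real_distribution (\<mu> v)" and \<nu>: "real_distribution \<nu>"
    and w: "weak_conv_on euclideanreal \<mu> \<nu> at_top" and x: "measure \<nu> {x} = 0"
  shows "((\<lambda>v::real. cdf (\<mu> v) x) \<longlongrightarrow> cdf \<nu> x) at_top"
proof (rule tendsto_at_topI_sequentially)
  fix V :: "nat \<Rightarrow> real" assume V: "filterlim V at_top sequentially"
  interpret \<nu>: real_distribution \<nu> by fact
  have "weak_conv_m (\<lambda>n. \<mu> (V n)) \<nu>"
  proof (rule integral_bdd_continuous_conv_imp_weak_conv)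
    fix f :: "real \<Rightarrow> real" assume f: "\<And>x. isCont f x" "\<And>x. \<bar>f x\<bar> \<le> 1"
    have "((\<lambda>v. integral\<^sup>L (\<mu> v) f) \<longlongrightarrow> integral\<^sup>L \<nu> f) at_top"
      using w[unfolded weak_conv_on_def, rule_format, of f] f
      by (auto simp: continuous_at_imp_continuous_on bounded_iff set_lebesgue_integral_def)
    then show "(\<lambda>n. integral\<^sup>L (\<mu> (V n)) f) \<longlonglongrightarrow> integral\<^sup>L \<nu> f"
      by (rule filterlim_compose[OF _ V])
  qed (use \<mu> \<nu> in auto)
  then show "(\<lambda>n. cdf (\<mu> (V n)) x) \<longlonglongrightarrow> cdf \<nu> x"
    using \<nu>.isCont_cdf x by (auto simp: weak_conv_m_def weak_conv_def)
qed

text \<open>A bounded continuous function on the line restricts to a test function on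
  \<open>S\<close>, and the complement of \<open>S\<close> is null for all laws involved, so the
  integrals agree.\<close>

lemma weak_conv_on_subspaceD:
  assumes S: "S \<in> sets borel"
    and \<mu>: "\<And>i. real_distribution (\<mu> i)" "\<And>i. AE x in \<mu> i. x \<in> S"
    and \<nu>: "real_distribution \<nu>" "AE x in \<nu>. x \<in> S"
    and w: "weak_conv_on (top_of_set S) \<mu> \<nu> F"
  shows "weak_conv_on euclideanreal \<mu> \<nu> F"
  unfolding weak_conv_on_def
proof safe
  fix g :: "real \<Rightarrow> real" assume g: "continuous_map euclideanreal euclideanreal g"
    and b: "bounded (g ` topspace euclideanreal)"
  have [measurable]: "g \<in> borel_measurable borel"
    using g by (simp add: borel_measurable_continuous_onI)
  have eq: "set_lebesgue_integral \<kappa> S g = set_lebesgue_integral \<kappa> (topspace euclideanreal) g"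
    if "real_distribution \<kappa>" "AE x in \<kappa>. x \<in> S" for \<kappa>
  proof -
    interpret real_distribution \<kappa> by fact
    have [measurable]: "S \<in> sets borel" by fact
    show ?thesis unfolding set_lebesgue_integral_def
      by (rule integral_cong_AE) (use that(2) in auto)
  qed
  have "continuous_map (top_of_set S) euclideanreal g" "bounded (g ` topspace (top_of_set S))"
    using g b by (auto intro: continuous_on_subset bounded_subset)
  with w have "((\<lambda>i. set_lebesgue_integral (\<mu> i) S g) \<longlongrightarrow> set_lebesgue_integral \<nu> S g) F"
    unfolding weak_conv_on_def by simp
  then show "((\<lambda>i. set_lebesgue_integral (\<mu> i) (topspace euclideanreal) g) \<longlongrightarrow>
      set_lebesgue_integral \<nu> (topspace euclideanreal) g) F"
    by (simp only: eq[OF \<mu>] eq[OF \<nu>])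
qed

text \<open>By the Galois connection a sublevel set of the quantile is the region below the graph of
  \<open>w \<mapsto> cdf (\<kappa> w) y\<close>, and this function is measurable because
  \<open>\<kappa>\<close> is a kernel.\<close>

lemma measurable_quantile_kernel:
  fixes \<kappa> :: "real \<Rightarrow> real measure"
  assumes \<kappa>: "\<kappa> \<in> borel \<rightarrow>\<^sub>M prob_algebra (borel :: real measure)"
  shows "(\<lambda>(w, x). quantile (\<kappa> w) x) \<in> borel \<Otimes>\<^sub>M uniform01 \<rightarrow>\<^sub>M borel"
proof (rule borel_measurableI_le)
  fix y :: real
  have rd: "real_distribution (\<kappa> w)" for w :: real
    using measurable_space[OF \<kappa>, of w]
    by (auto simp: space_prob_algebra real_distribution_def real_distribution_axioms_def)
  have [measurable]: "(\<lambda>w. cdf (\<kappa> w) y) \<in> borel_measurable borel"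
    unfolding cdf_def using measurable_prob_algebraD[OF \<kappa>] by (rule measure_measurable_subprob_algebra2[rotated]) auto
  have "(\<lambda>x. x) \<in> uniform01 \<rightarrow>\<^sub>M borel" by (simp add: measurable_restrict_space1)
  then have [measurable]: "{z \<in> space (borel \<Otimes>\<^sub>M uniform01). snd z \<le> cdf (\<kappa> (fst z)) y} \<in> sets (borel \<Otimes>\<^sub>M uniform01)"
    by measurable
  show "{z \<in> space (borel \<Otimes>\<^sub>M uniform01). (\<lambda>(w, x). quantile (\<kappa> w) x) z \<le> y} \<in> sets (borel \<Otimes>\<^sub>M uniform01)"
    (is "?A \<in> _")
  proof -
    have "?A = {z \<in> space (borel \<Otimes>\<^sub>M uniform01). snd z \<le> cdf (\<kappa> (fst z)) y}"
      by (auto simp: space_pair_measure quantile_le_iff[OF rd])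
    then show ?thesis by simp
  qed
qed

section \<open>Paths driven by independent noise\<close>

text \<open>Coordinate 0 of the noise produces the initial state, and coordinate
  \<open>Suc s\<close> drives the transition into time \<open>Suc s\<close>. The update may depend
  on time, which lets one notion cover both the chain and the hidden tail chain.\<close>

primrec driven_path :: "('a \<Rightarrow> real) \<Rightarrow> (nat \<Rightarrow> real \<Rightarrow> 'a \<Rightarrow> real) \<Rightarrow> (nat \<Rightarrow> 'a) \<Rightarrow> nat \<Rightarrow> real" where
  "driven_path f q \<omega> 0 = f (\<omega> 0)"
| "driven_path f q \<omega> (Suc s) = q s (driven_path f q \<omega> s) (\<omega> (Suc s))"

lemma driven_path_cong: "(\<And>j. j \<le> i \<Longrightarrow> \<omega> j = \<omega>' j) \<Longrightarrow> driven_path f q \<omega> i = driven_path f q \<omega>' i"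
  by (induction i) auto

lemma measurable_driven_path:
  assumes f: "f \<in> U \<rightarrow>\<^sub>M borel"
    and q: "\<And>s. (\<lambda>(y, x). q s y x) \<in> borel \<Otimes>\<^sub>M U \<rightarrow>\<^sub>M borel"
    and i: "i \<le> t"
  shows "(\<lambda>\<omega>. driven_path f q \<omega> i) \<in> PiM {..t} (\<lambda>_. U) \<rightarrow>\<^sub>M borel"
  using i
proof (induction i)
  case 0
  have "(\<lambda>\<omega>. \<omega> 0) \<in> PiM {..t} (\<lambda>_. U) \<rightarrow>\<^sub>M U" by (rule measurable_component_singleton) simp
  from measurable_compose[OF this f] show ?case by simp
next
  case (Suc i)
  have 1: "(\<lambda>\<omega>. \<omega> (Suc i)) \<in> PiM {..t} (\<lambda>_. U) \<rightarrow>\<^sub>M U"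
    by (rule measurable_component_singleton) (use Suc in simp)
  have "(\<lambda>\<omega>. driven_path f q \<omega> i) \<in> PiM {..t} (\<lambda>_. U) \<rightarrow>\<^sub>M borel" using Suc by simp
  from measurable_compose[OF measurable_Pair[OF this 1] q[of i]] show ?case by simp
qed

text \<open>Induction on \<open>t\<close>. Boxes determine finite measures on a finite product, and
  for both processes the probability of a box up to time \<open>Suc s\<close> is the integral of the
  same function of the path up to time \<open>s\<close>.\<close>

lemma distr_eq_distr_driven_path:
  assumes U: "prob_space U" and M: "prob_space M"
    and X [measurable]: "\<And>i. X i \<in> borel_measurable M"
    and f [measurable]: "f \<in> U \<rightarrow>\<^sub>M borel"
    and q [measurable]: "\<And>s. (\<lambda>(y, x). q s y x) \<in> borel \<Otimes>\<^sub>M U \<rightarrow>\<^sub>M borel"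
    and init: "distr M borel (X 0) = distr U borel f"
    and step: "\<And>s A. (\<And>i. i \<le> Suc s \<Longrightarrow> A i \<in> sets borel) \<Longrightarrow>
      emeasure M {\<omega>\<in>space M. \<forall>i\<le>Suc s. X i \<omega> \<in> A i} =
      (\<integral>\<^sup>+\<omega>. indicator {\<omega>\<in>space M. \<forall>i\<le>s. X i \<omega> \<in> A i} \<omega> *
        (\<integral>\<^sup>+x. indicator (A (Suc s)) (q s (X s \<omega>) x) \<partial>U) \<partial>M)"
  shows "distr M (PiM {..t} (\<lambda>_. borel)) (\<lambda>\<omega>. \<lambda>i\<in>{..t}. X i \<omega>) =
    distr (PiM {..t} (\<lambda>_. U)) (PiM {..t} (\<lambda>_. borel)) (\<lambda>\<omega>. \<lambda>i\<in>{..t}. driven_path f q \<omega> i)"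
proof (induction t)
  interpret U: prob_space U by fact
  interpret M: prob_space M by fact
  have W: "prob_space (PiM {..t::nat} (\<lambda>_. U))" for t by (intro prob_space_PiM U)
  note path = measurable_driven_path[of f U q, OF f q]
  have meas_path: "(\<lambda>\<omega>. \<lambda>i\<in>{..t}. driven_path f q \<omega> i) \<in> PiM {..t} (\<lambda>_. U) \<rightarrow>\<^sub>M PiM {..t} (\<lambda>_. borel)" for t
    by (intro measurable_restrict path) auto
  have meas_X: "(\<lambda>\<omega>. \<lambda>i\<in>{..t}. X i \<omega>) \<in> M \<rightarrow>\<^sub>M PiM {..t} (\<lambda>_. borel)" for t :: nat
    by (intro measurable_restrict X)
  have eqI: "distr M (PiM {..t} (\<lambda>_. borel)) (\<lambda>\<omega>. \<lambda>i\<in>{..t}. X i \<omega>) =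
    distr (PiM {..t} (\<lambda>_. U)) (PiM {..t} (\<lambda>_. borel)) (\<lambda>\<omega>. \<lambda>i\<in>{..t}. driven_path f q \<omega> i)"
    if eq: "\<And>A. (\<And>i. i \<le> t \<Longrightarrow> A i \<in> sets borel) \<Longrightarrow>
      emeasure M {\<omega>\<in>space M. \<forall>i\<le>t. X i \<omega> \<in> A i} =
      emeasure (PiM {..t} (\<lambda>_. U)) {\<omega>\<in>space (PiM {..t} (\<lambda>_. U)). \<forall>i\<le>t. driven_path f q \<omega> i \<in> A i}" for t
  proof (rule measure_eqI_PiM_finite[where A="\<lambda>_. space (PiM {..t} (\<lambda>_. borel))"])
    fix A :: "nat \<Rightarrow> real set" assume A: "\<And>i. i \<in> {..t} \<Longrightarrow> A i \<in> sets borel"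
    then have B: "Pi\<^sub>E {..t} A \<in> sets (PiM {..t} (\<lambda>_. borel))" by (intro sets_PiM_I_finite) auto
    have *: "(\<lambda>\<omega>. \<lambda>i\<in>{..t}. g \<omega> i) -` Pi\<^sub>E {..t} A \<inter> S = {\<omega>\<in>S. \<forall>i\<le>t. g \<omega> i \<in> A i}"
      for g :: "'z \<Rightarrow> nat \<Rightarrow> real" and S
      by (auto simp: PiE_iff)
    show "emeasure (distr M (PiM {..t} (\<lambda>_. borel)) (\<lambda>\<omega>. \<lambda>i\<in>{..t}. X i \<omega>)) (Pi\<^sub>E {..t} A) =
      emeasure (distr (PiM {..t} (\<lambda>_. U)) (PiM {..t} (\<lambda>_. borel)) (\<lambda>\<omega>. \<lambda>i\<in>{..t}. driven_path f q \<omega> i)) (Pi\<^sub>E {..t} A)"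
      unfolding emeasure_distr[OF meas_X B] emeasure_distr[OF meas_path B]
      unfolding * by (rule eq) (use A in auto)
  next
    show "range (\<lambda>_. space (PiM {..t} (\<lambda>_. borel))) \<subseteq> prod_algebra {..t} (\<lambda>_. borel :: real measure)"
      by (auto simp: space_PiM intro!: prod_algebraI_finite)
    show "emeasure (distr M (PiM {..t} (\<lambda>_. borel)) (\<lambda>\<omega>. \<lambda>i\<in>{..t}. X i \<omega>))
      (space (PiM {..t} (\<lambda>_. borel))) \<noteq> \<infinity>" for i :: nat
      using finite_measure.emeasure_finite[OF prob_space.finite_measure[OF M.prob_space_distr[OF meas_X]]] by simp
  qed auto
  {
    case 0
    show ?case
    proof (rule eqI)
      fix A :: "nat \<Rightarrow> real set" assume "\<And>i. i \<le> 0 \<Longrightarrow> A i \<in> sets borel"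
      then have A [measurable]: "A 0 \<in> sets borel" by simp
      have 1: "distr (PiM {..0} (\<lambda>_. U)) U (\<lambda>\<omega>. \<omega> (0::nat)) = U"
        by (rule distr_PiM_component) (auto intro: U)
      have m: "(\<lambda>\<omega>. \<omega> 0) \<in> PiM {..0::nat} (\<lambda>_. U) \<rightarrow>\<^sub>M U"
        by (rule measurable_component_singleton) simp
      have "emeasure M {\<omega>\<in>space M. X 0 \<omega> \<in> A 0} = emeasure (distr M borel (X 0)) (A 0)"
        by (subst emeasure_distr) (auto intro!: arg_cong[where f="emeasure M"])
      also have "\<dots> = emeasure U (f -` A 0 \<inter> space U)"
        unfolding init by (subst emeasure_distr) auto
      also have "\<dots> = emeasure (distr (PiM {..0} (\<lambda>_. U)) U (\<lambda>\<omega>. \<omega> (0::nat))) (f -` A 0 \<inter> space U)"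
        by (simp only: 1)
      also have "\<dots> = emeasure (PiM {..0} (\<lambda>_. U)) {\<omega>\<in>space (PiM {..0::nat} (\<lambda>_. U)). f (\<omega> 0) \<in> A 0}"
        using measurable_space[OF m]
        by (subst emeasure_distr[OF m]) (auto simp del: atMost_0 intro!: arg_cong2[where f=emeasure])
      finally show "emeasure M {\<omega>\<in>space M. \<forall>i\<le>0. X i \<omega> \<in> A i} =
        emeasure (PiM {..0} (\<lambda>_. U)) {\<omega>\<in>space (PiM {..0} (\<lambda>_. U)). \<forall>i\<le>0. driven_path f q \<omega> i \<in> A i}"
        by simp
    qed
  next
    case (Suc s)
    show ?case
    proof (rule eqI)
      fix A :: "nat \<Rightarrow> real set" assume A: "\<And>i. i \<le> Suc s \<Longrightarrow> A i \<in> sets borel"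
      let ?W = "\<lambda>s. PiM {..s::nat} (\<lambda>_. U)"
      interpret W: prob_space "?W s" by (rule W)
      interpret UW: pair_prob_space U "?W s" ..
      have [measurable]: "A (Suc s) \<in> sets borel" using A by simp
      have B [measurable]: "Pi\<^sub>E {..s} A \<in> sets (PiM {..s} (\<lambda>_. borel))"
        using A by (intro sets_PiM_I_finite) auto
      have [measurable]: "(\<lambda>p. p s) \<in> PiM {..s} (\<lambda>_. borel :: real measure) \<rightarrow>\<^sub>M borel"
        by (rule measurable_component_singleton) simp
      \<comment> \<open>The probability that fresh noise moves the state at time \<open>s\<close>
        into \<open>A (Suc s)\<close>, on paths that have stayed in the box so far.\<close>
      define h :: "(nat \<Rightarrow> real) \<Rightarrow> ennreal" where
        "h p = indicator (Pi\<^sub>E {..s} A) p * (\<integral>\<^sup>+x. indicator (A (Suc s)) (q s (p s) x) \<partial>U)" for p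
      have h: "h \<in> borel_measurable (PiM {..s} (\<lambda>_. borel))"
        unfolding h_def by measurable
      define J where "J = {\<omega>\<in>space (?W (Suc s)). \<forall>i\<le>Suc s. driven_path f q \<omega> i \<in> A i}"
      have J: "J \<in> sets (?W (Suc s))"
      proof -
        have "J = (\<lambda>\<omega>. \<lambda>i\<in>{..Suc s}. driven_path f q \<omega> i) -` Pi\<^sub>E {..Suc s} A \<inter> space (?W (Suc s))"
          by (auto simp: J_def PiE_iff)
        also have "\<dots> \<in> sets (?W (Suc s))"
          by (rule measurable_sets[OF meas_path]) (use A in \<open>auto intro!: sets_PiM_I_finite\<close>)
        finally show ?thesis .
      qed
      \<comment> \<open>Splits off the last noise coordinate. The states up to time \<open>s\<close>
        do not see it, so integrating it out first by Fubini leaves \<open>h\<close> of the earlier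
        path.\<close>
      let ?up = "\<lambda>(x, \<omega>). fun_upd \<omega> (Suc s) x"
      have up: "?up \<in> U \<Otimes>\<^sub>M ?W s \<rightarrow>\<^sub>M ?W (Suc s)"
        unfolding atMost_Suc by measurable
      have "distr (U \<Otimes>\<^sub>M ?W s) (?W (Suc s)) ?up = ?W (Suc s)"
        unfolding atMost_Suc by (rule distr_pair_PiM_eq_PiM) (auto intro: U)
      then have "emeasure (?W (Suc s)) J = emeasure (distr (U \<Otimes>\<^sub>M ?W s) (?W (Suc s)) ?up) J" by simp
      also have "\<dots> = emeasure (U \<Otimes>\<^sub>M ?W s) (?up -` J \<inter> space (U \<Otimes>\<^sub>M ?W s))"
        by (rule emeasure_distr[OF up J])
      also have "\<dots> = (\<integral>\<^sup>+\<omega>. emeasure U ((\<lambda>x. (x, \<omega>)) -` (?up -` J \<inter> space (U \<Otimes>\<^sub>M ?W s))) \<partial>?W s)"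
        by (rule UW.emeasure_pair_measure_alt2) (rule measurable_sets[OF up J])
      also have "\<dots> = (\<integral>\<^sup>+\<omega>. h (\<lambda>i\<in>{..s}. driven_path f q \<omega> i) \<partial>?W s)"
      proof (rule nn_integral_cong)
        fix \<omega> assume \<omega>: "\<omega> \<in> space (?W s)"
        have upd: "driven_path f q (fun_upd \<omega> (Suc s) x) i = driven_path f q \<omega> i" if "i \<le> s" for i x
          using that by (intro driven_path_cong) auto
        have m: "(\<lambda>x. q s (driven_path f q \<omega> s) x) \<in> U \<rightarrow>\<^sub>M borel" by measurable
        have "((\<lambda>x. (x, \<omega>)) -` (?up -` J \<inter> space (U \<Otimes>\<^sub>M ?W s))) =
          (if \<forall>i\<le>s. driven_path f q \<omega> i \<in> A i then (\<lambda>x. q s (driven_path f q \<omega> s) x) -` A (Suc s) \<inter> space U else {})"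
          using \<omega> measurable_space[OF up] by (auto simp: J_def space_pair_measure le_Suc_eq upd)
        moreover have "(\<integral>\<^sup>+x. indicator (A (Suc s)) (q s (driven_path f q \<omega> s) x) \<partial>U) =
          emeasure U ((\<lambda>x. q s (driven_path f q \<omega> s) x) -` A (Suc s) \<inter> space U)"
          by (subst nn_integral_indicator[OF measurable_sets[OF m], symmetric])
            (simp, rule nn_integral_cong, auto split: split_indicator)
        ultimately show "emeasure U ((\<lambda>x. (x, \<omega>)) -` (?up -` J \<inter> space (U \<Otimes>\<^sub>M ?W s))) =
          h (\<lambda>i\<in>{..s}. driven_path f q \<omega> i)"
          by (auto simp: h_def PiE_iff split: split_indicator)
      qed
      also have "\<dots> = (\<integral>\<^sup>+p. h p \<partial>distr (?W s) (PiM {..s} (\<lambda>_. borel)) (\<lambda>\<omega>. \<lambda>i\<in>{..s}. driven_path f q \<omega> i))"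
        by (rule nn_integral_distr[symmetric, OF meas_path]) (simp add: h)
      also have "\<dots> = (\<integral>\<^sup>+p. h p \<partial>distr M (PiM {..s} (\<lambda>_. borel)) (\<lambda>\<omega>. \<lambda>i\<in>{..s}. X i \<omega>))"
        by (simp only: Suc.IH)
      also have "\<dots> = (\<integral>\<^sup>+\<omega>. h (\<lambda>i\<in>{..s}. X i \<omega>) \<partial>M)"
        by (rule nn_integral_distr[OF meas_X]) (simp add: h)
      also have "\<dots> = emeasure M {\<omega>\<in>space M. \<forall>i\<le>Suc s. X i \<omega> \<in> A i}"
        by (subst step[of s A, OF A])
          (simp, rule nn_integral_cong, auto simp: h_def PiE_iff split: split_indicator)
      finally show "emeasure M {\<omega>\<in>space M. \<forall>i\<le>Suc s. X i \<omega> \<in> A i} =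
        emeasure (?W (Suc s)) {\<omega>\<in>space (?W (Suc s)). \<forall>i\<le>Suc s. driven_path f q \<omega> i \<in> A i}"
        by (simp add: J_def)
    qed
  }
qed

section \<open>The Markov chain conditioned on a large initial state\<close>

text \<open>
  Boxes determine measures on finite products, so the Markov property is needed only for events
  \<open>X 0 \<in> A 0, \<dots>, X s \<in> A s\<close> of the past.
\<close>

lemma markov_chain_box_step:
  assumes chain: "homogeneous_markov_chain M X F \<pi>"
    and A: "\<And>i. i \<le> Suc s \<Longrightarrow> A i \<in> sets borel"
  shows "emeasure M {\<omega>\<in>space M. \<forall>i\<le>Suc s. X i \<omega> \<in> A i} =
    (\<integral>\<^sup>+\<omega>. indicator {\<omega>\<in>space M. \<forall>i\<le>s. X i \<omega> \<in> A i} \<omega> * emeasure (\<pi> (X s \<omega>)) (A (Suc s)) \<partial>M)"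
proof -
  from chain have "prob_space M" and X [measurable]: "\<And>i. X i \<in> borel_measurable M"
    and \<pi> [measurable]: "\<pi> \<in> borel \<rightarrow>\<^sub>M prob_algebra borel"
    by (auto simp: homogeneous_markov_chain_def)
  interpret prob_space M by fact
  define B where "B = A (Suc s)"
  have [measurable]: "B \<in> sets borel" using A by (simp add: B_def)
  have p\<pi>: "prob_space (\<pi> v)" for v using measurable_space[OF \<pi>, of v] by (simp add: space_prob_algebra)
  have [measurable]: "(\<lambda>v. measure (\<pi> v) B) \<in> borel_measurable borel"
    using measurable_prob_algebraD[OF \<pi>] by (rule measure_measurable_subprob_algebra2[rotated]) auto
  define E where "E = {\<omega>\<in>space M. \<forall>i\<le>s. X i \<omega> \<in> A i}"
  let ?f = "indicat_real (X (Suc s) -` B \<inter> space M)"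
  have box: "{\<omega>\<in>space M. \<forall>i\<le>Suc s. X i \<omega> \<in> A i} = E \<inter> (X (Suc s) -` B \<inter> space M)"
  proof -
    have all_le_Suc: "(\<forall>i\<le>Suc s. P i) \<longleftrightarrow> (\<forall>i\<le>s. P i) \<and> P (Suc s)" for P :: "nat \<Rightarrow> bool"
      by (metis le_Suc_eq)
    show ?thesis unfolding E_def B_def all_le_Suc by auto
  qed
  have pm: "(\<lambda>\<omega>. \<lambda>i\<in>{..s}. X i \<omega>) \<in> M \<rightarrow>\<^sub>M (\<Pi>\<^sub>M i\<in>{..s}. borel)" by measurable
  \<comment> \<open>The box lies in the sigma-algebra of the past, so the conditional expectation
    may be integrated over it.\<close>
  have EP: "E \<in> sets (past M X s)"
  proof -
    have "E = (\<lambda>\<omega>. \<lambda>i\<in>{..s}. X i \<omega>) -` Pi\<^sub>E {..s} A \<inter> space M" by (auto simp: E_def PiE_iff)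
    then show ?thesis unfolding past_def
      using A by (auto intro!: in_vimage_algebra sets_PiM_I_finite)
  qed
  interpret finite_measure_subalgebra M "past M X s"
  proof
    have "sets (past M X s) \<subseteq> sets M"
      using measurable_sets[OF pm] measurable_space[OF pm]
      unfolding past_def by (subst sets_vimage_algebra2) auto
    then show "subalgebra M (past M X s)" by (simp add: subalgebra_def past_def)
  qed
  have EM [measurable]: "E \<in> sets M" using EP subalg by (auto simp: subalgebra_def)
  have f: "integrable M ?f"
    by (rule integrable_const_bound[where B=1]) (auto split: split_indicator)
  have "AE \<omega> in M. real_cond_exp M (past M X s) ?f \<omega> = measure (\<pi> (X s \<omega>)) B"
    using chain by (simp add: homogeneous_markov_chain_def)
  then have "(\<integral>\<omega>\<in>E. ?f \<omega> \<partial>M) = (\<integral>\<omega>\<in>E. measure (\<pi> (X s \<omega>)) B \<partial>M)"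
    by (subst real_cond_exp_intA[OF f EP]) (auto intro!: set_lebesgue_integral_cong_AE)
  also have "(\<integral>\<omega>\<in>E. ?f \<omega> \<partial>M) = measure M {\<omega>\<in>space M. \<forall>i\<le>Suc s. X i \<omega> \<in> A i}"
  proof -
    have "(\<integral>\<omega>\<in>E. ?f \<omega> \<partial>M) = (\<integral>\<omega>. indicator {\<omega>\<in>space M. \<forall>i\<le>Suc s. X i \<omega> \<in> A i} \<omega> \<partial>M)"
      unfolding set_lebesgue_integral_def
      by (rule Bochner_Integration.integral_cong) (simp_all add: box indicator_inter_arith)
    also have "\<dots> = measure M {\<omega>\<in>space M. \<forall>i\<le>Suc s. X i \<omega> \<in> A i}"
      unfolding box using EM by (subst Bochner_Integration.integral_indicator) (auto intro!: arg_cong[where f="measure M"])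
    finally show ?thesis .
  qed
  finally have eq: "measure M {\<omega>\<in>space M. \<forall>i\<le>Suc s. X i \<omega> \<in> A i} =
    (\<integral>\<omega>. indicator E \<omega> * measure (\<pi> (X s \<omega>)) B \<partial>M)"
    by (simp add: set_lebesgue_integral_def)
  \<comment> \<open>The identity so far is between real integrals; since the integrand is bounded by
    1, it carries over to nonnegative extended integrals.\<close>
  have "(\<integral>\<^sup>+\<omega>. indicator E \<omega> * emeasure (\<pi> (X s \<omega>)) B \<partial>M) =
    (\<integral>\<^sup>+\<omega>. ennreal (indicator E \<omega> * measure (\<pi> (X s \<omega>)) B) \<partial>M)"
    by (rule nn_integral_cong)
      (simp add: finite_measure.emeasure_eq_measure[OF prob_space.finite_measure[OF p\<pi>]] split: split_indicator)
  also have "\<dots> = ennreal (\<integral>\<omega>. indicator E \<omega> * measure (\<pi> (X s \<omega>)) B \<partial>M)"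
    by (rule nn_integral_eq_integral)
      (auto intro!: integrable_const_bound[where B=1] prob_space.prob_le_1[OF p\<pi>] split: split_indicator)
  also have "\<dots> = emeasure M {\<omega>\<in>space M. \<forall>i\<le>Suc s. X i \<omega> \<in> A i}"
    by (simp only: eq[symmetric] emeasure_eq_measure)
  finally show ?thesis by (simp add: E_def B_def)
qed

text \<open>Conditioning on an event of the initial state keeps the transition kernel: both sides
  come from the unconditioned identity for a smaller box, divided by the same normalising
  mass.\<close>

lemma conditioned_markov_chain_box_step:
  fixes u :: real
  assumes chain: "homogeneous_markov_chain M X F \<pi>"
    and A: "\<And>i. i \<le> Suc s \<Longrightarrow> A i \<in> sets borel"
  defines "S \<equiv> {\<omega>\<in>space M. X 0 \<omega> > u}"
  defines "M' \<equiv> uniform_measure M S"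
  shows "emeasure M' {\<omega>\<in>space M. \<forall>i\<le>Suc s. X i \<omega> \<in> A i} =
    (\<integral>\<^sup>+\<omega>. indicator {\<omega>\<in>space M. \<forall>i\<le>s. X i \<omega> \<in> A i} \<omega> * emeasure (\<pi> (X s \<omega>)) (A (Suc s)) \<partial>M')"
proof -
  from chain have X [measurable]: "\<And>i. X i \<in> borel_measurable M"
    and \<pi> [measurable]: "\<pi> \<in> borel \<rightarrow>\<^sub>M prob_algebra borel"
    by (auto simp: homogeneous_markov_chain_def)
  have S [measurable]: "S \<in> sets M" unfolding S_def by measurable
  \<comment> \<open>Conditioning on \<open>X 0 > u\<close> only shrinks the first side of a box.\<close>
  define A' where "A' i = (if i = 0 then A 0 \<inter> {u<..} else A i)" for i
  have box: "{\<omega>\<in>space M. \<forall>i\<le>n. X i \<omega> \<in> A i} \<in> sets M" if "n \<le> Suc s" for n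
  proof -
    have "{\<omega>\<in>space M. X i \<omega> \<in> A i} \<in> sets M" if "i \<in> {..n}" for i
    proof -
      have [measurable]: "A i \<in> sets borel" using A that \<open>n \<le> Suc s\<close> by simp
      show ?thesis by measurable
    qed
    then have "{\<omega>\<in>space M. \<forall>i\<in>{..n}. X i \<omega> \<in> A i} \<in> sets M" by (intro sets.sets_Collect_finite_All') auto
    then show ?thesis by (simp only: Ball_def atMost_iff)
  qed
  have cut: "{\<omega>\<in>space M. \<forall>i\<le>n. X i \<omega> \<in> A' i} = S \<inter> {\<omega>\<in>space M. \<forall>i\<le>n. X i \<omega> \<in> A i}" for n
  proof -
    have "X i \<omega> \<in> A' i \<longleftrightarrow> X i \<omega> \<in> A i \<and> (i = 0 \<longrightarrow> u < X 0 \<omega>)" for i \<omega>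
      by (cases i) (auto simp: A'_def)
    then show ?thesis by (auto simp: S_def)
  qed
  have kern [measurable]: "(\<lambda>v. emeasure (\<pi> v) (A (Suc s))) \<in> borel_measurable borel"
    using measurable_prob_algebraD[OF \<pi>] by (rule emeasure_measurable_subprob_algebra2[rotated]) (use A in auto)
  have "emeasure M' {\<omega>\<in>space M. \<forall>i\<le>Suc s. X i \<omega> \<in> A i} =
    emeasure M (S \<inter> {\<omega>\<in>space M. \<forall>i\<le>Suc s. X i \<omega> \<in> A i}) / emeasure M S"
    unfolding M'_def by (rule emeasure_uniform_measure[OF S box[OF order_refl]])
  also have "emeasure M (S \<inter> {\<omega>\<in>space M. \<forall>i\<le>Suc s. X i \<omega> \<in> A i}) =
    (\<integral>\<^sup>+\<omega>. indicator {\<omega>\<in>space M. \<forall>i\<le>s. X i \<omega> \<in> A' i} \<omega> * emeasure (\<pi> (X s \<omega>)) (A' (Suc s)) \<partial>M)"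
    unfolding cut[symmetric]
    by (rule markov_chain_box_step[OF chain]) (use A in \<open>auto simp: A'_def\<close>)
  also have "\<dots> = (\<integral>\<^sup>+\<omega>. indicator {\<omega>\<in>space M. \<forall>i\<le>s. X i \<omega> \<in> A i} \<omega> * emeasure (\<pi> (X s \<omega>)) (A (Suc s))
      * indicator S \<omega> \<partial>M)"
    unfolding cut by (rule nn_integral_cong) (simp add: A'_def indicator_inter_arith mult_ac)
  also have "\<dots> / emeasure M S = (\<integral>\<^sup>+\<omega>. indicator {\<omega>\<in>space M. \<forall>i\<le>s. X i \<omega> \<in> A i} \<omega> *
      emeasure (\<pi> (X s \<omega>)) (A (Suc s)) \<partial>M')"
    unfolding M'_def
    by (intro nn_integral_uniform_measure[OF _ S, symmetric] borel_measurable_times_ennreal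
      borel_measurable_indicator box measurable_compose[OF X kern]) simp
  finally show ?thesis .
qed

text \<open>Ensures that conditioning on an exceedance of \<open>u\<close> gives a probability
  measure. Some point beyond \<open>u\<close> has distribution function below 1, and monotonicity
  passes this down to \<open>u\<close>.\<close>

lemma emeasure_tail_pos:
  assumes F: "real_distribution F" and up: "upper_endpoint F = \<infinity>"
  shows "emeasure F {u<..} \<noteq> 0"
proof -
  interpret real_distribution F by fact
  have "ereal u < (SUP x\<in>{x. cdf F x < 1}. ereal x)" using up by (simp add: upper_endpoint_def)
  then obtain x where "u < x" "cdf F x < 1" by (auto simp: less_SUP_iff)
  moreover from this have "cdf F u \<le> cdf F x" by (intro cdf_nondecreasing) simp
  ultimately have "cdf F u < 1" by simp
  moreover have "prob {u<..} = 1 - cdf F u"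
    using prob_compl[of "{..u}"] by (simp add: cdf_def Compl_eq_Diff_UNIV[symmetric])
  ultimately show ?thesis by (simp add: emeasure_eq_measure)
qed

text \<open>Serves to identify the initial law of the conditioned chain with the conditioned initial
  law.\<close>

lemma distr_uniform_measure_vimage:
  assumes X: "X \<in> M \<rightarrow>\<^sub>M N" and A: "A \<in> sets N"
  shows "distr (uniform_measure M {\<omega>\<in>space M. X \<omega> \<in> A}) N X = uniform_measure (distr M N X) A"
proof (rule measure_eqI)
  fix B assume "B \<in> sets (distr (uniform_measure M {\<omega>\<in>space M. X \<omega> \<in> A}) N X)"
  then have B [measurable]: "B \<in> sets N" by simp
  note [measurable] = X A
  have S: "{\<omega>\<in>space M. X \<omega> \<in> A} = X -` A \<inter> space M" by auto
  have "emeasure (distr (uniform_measure M {\<omega>\<in>space M. X \<omega> \<in> A}) N X) B =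
    emeasure M ((X -` A \<inter> space M) \<inter> (X -` B \<inter> space M)) / emeasure M (X -` A \<inter> space M)"
    unfolding S by (subst emeasure_distr) (simp_all add: measurable_sets[OF X])
  also have "(X -` A \<inter> space M) \<inter> (X -` B \<inter> space M) = X -` (A \<inter> B) \<inter> space M" by auto
  finally show "emeasure (distr (uniform_measure M {\<omega>\<in>space M. X \<omega> \<in> A}) N X) B =
    emeasure (uniform_measure (distr M N X) A) B"
    by (simp add: emeasure_distr)
qed simp

section \<open>The law of the hidden tail chain\<close>

text \<open>Rectangles determine a product of sigma-finite measures, and independence gives the mass
  of each rectangle.\<close>

lemma distr_Pair_indep_rv:
  assumes N: "prob_space N" and ind: "indep_rv N S U T V"
  shows "distr N (S \<Otimes>\<^sub>M T) (\<lambda>\<omega>. (U \<omega>, V \<omega>)) = distr N S U \<Otimes>\<^sub>M distr N T V"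
proof -
  interpret N: prob_space N by fact
  have U [measurable]: "U \<in> N \<rightarrow>\<^sub>M S" and V [measurable]: "V \<in> N \<rightarrow>\<^sub>M T"
    and ind': "N.indep_set {U -` A \<inter> space N | A. A \<in> sets S} {V -` A \<inter> space N | A. A \<in> sets T}"
    using ind by (auto simp: indep_rv_def)
  interpret DU: prob_space "distr N S U" by (rule N.prob_space_distr) fact
  interpret DV: prob_space "distr N T V" by (rule N.prob_space_distr) fact
  have "distr N S U \<Otimes>\<^sub>M distr N T V = distr N (S \<Otimes>\<^sub>M T) (\<lambda>\<omega>. (U \<omega>, V \<omega>))"
  proof (rule pair_measure_eqI)
    show "sigma_finite_measure (distr N S U)" "sigma_finite_measure (distr N T V)" ..
    fix A B assume A: "A \<in> sets (distr N S U)" and B: "B \<in> sets (distr N T V)"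
    then have [measurable]: "A \<in> sets S" "B \<in> sets T" by auto
    have "N.prob ((U -` A \<inter> space N) \<inter> (V -` B \<inter> space N)) =
      N.prob (U -` A \<inter> space N) * N.prob (V -` B \<inter> space N)"
      using A B by (intro N.indep_setD[OF ind']) auto
    moreover have "(U -` A \<inter> space N) \<inter> (V -` B \<inter> space N) = (\<lambda>\<omega>. (U \<omega>, V \<omega>)) -` (A \<times> B) \<inter> space N"
      by auto
    ultimately show "emeasure (distr N S U) A * emeasure (distr N T V) B =
      emeasure (distr N (S \<Otimes>\<^sub>M T) (\<lambda>\<omega>. (U \<omega>, V \<omega>))) (A \<times> B)"
      by (simp add: emeasure_distr N.emeasure_eq_measure ennreal_mult)
  qed simp
  then show ?thesis ..
qed

text \<open>Inverse transform sampling in each coordinate, compared on boxes.\<close>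

lemma distr_quantile_PiM:
  assumes I: "finite I" and D: "\<And>i. real_distribution (D i)"
  shows "distr (PiM I (\<lambda>_. uniform01)) (PiM I (\<lambda>_. borel)) (\<lambda>\<omega>. \<lambda>i\<in>I. quantile (D i) (\<omega> i)) = PiM I D"
proof -
  interpret D: real_distribution "D i" for i by (rule D)
  interpret P: product_sigma_finite D ..
  interpret Un: prob_space uniform01 by (rule prob_space_uniform01)
  interpret UP: product_sigma_finite "\<lambda>_. uniform01" ..
  note [measurable] = measurable_quantile[OF D]
  have m: "(\<lambda>\<omega>. \<lambda>i\<in>I. quantile (D i) (\<omega> i)) \<in> PiM I (\<lambda>_. uniform01) \<rightarrow>\<^sub>M PiM I (\<lambda>_. borel)"
    by measurable
  show ?thesis
  proof (rule P.PiM_eqI[OF I])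
    show "sets (distr (PiM I (\<lambda>_. uniform01)) (PiM I (\<lambda>_. borel)) (\<lambda>\<omega>. \<lambda>i\<in>I. quantile (D i) (\<omega> i))) =
      sets (PiM I D)" by (simp cong: sets_PiM_cong)
    fix A assume "\<And>i. i \<in> I \<Longrightarrow> A i \<in> sets (D i)"
    then have A: "\<And>i. i \<in> I \<Longrightarrow> A i \<in> sets borel" by simp
    let ?B = "\<lambda>i. quantile (D i) -` A i \<inter> space uniform01"
    have "emeasure (distr (PiM I (\<lambda>_. uniform01)) (PiM I (\<lambda>_. borel)) (\<lambda>\<omega>. \<lambda>i\<in>I. quantile (D i) (\<omega> i))) (Pi\<^sub>E I A) =
      emeasure (PiM I (\<lambda>_. uniform01)) (Pi\<^sub>E I ?B)"
      using A I
      by (subst emeasure_distr[OF m]) (auto intro!: sets_PiM_I_finite arg_cong2[where f=emeasure] simp: PiE_iff space_PiM)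
    also have "\<dots> = (\<Prod>i\<in>I. emeasure uniform01 (?B i))"
      by (rule UP.emeasure_PiM[OF I]) (use A in measurable)
    also have "\<dots> = (\<Prod>i\<in>I. emeasure (D i) (A i))"
    proof (rule prod.cong)
      fix i assume "i \<in> I"
      then show "emeasure uniform01 (?B i) = emeasure (D i) (A i)"
        using emeasure_distr[OF measurable_quantile[OF D] A, of i i] distr_quantile[OF D, of i] by simp
    qed simp
    finally show "emeasure (distr (PiM I (\<lambda>_. uniform01)) (PiM I (\<lambda>_. borel)) (\<lambda>\<omega>. \<lambda>i\<in>I. quantile (D i) (\<omega> i)))
      (Pi\<^sub>E I A) = (\<Prod>i\<in>I. emeasure (D i) (A i))" .
  qed
qed

text \<open>Independence of \<open>Y 1\<close> from the whole innovation sequence and mutual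
  independence of the innovations combine to i.i.d. noise. Position \<open>i \<ge> 2\<close> holds
  \<open>\<epsilon> (i - 1)\<close>, the innovation that enters \<open>Y i\<close>.\<close>

lemma hidden_tail_chain_noise_law:
  assumes tail: "hidden_tail_chain N K \<psi>a \<psi>b Y \<epsilon>" and K: "real_distribution K" and t: "t \<ge> 1"
  shows "distr N (PiM {1..t} (\<lambda>_. borel)) (\<lambda>\<omega>. \<lambda>i\<in>{1..t}. if i = 1 then Y 1 \<omega> else \<epsilon> (i - 1) \<omega>) =
    PiM {1..t} (\<lambda>_. K)"
proof -
  interpret K: real_distribution K by fact
  interpret P: product_sigma_finite "\<lambda>_::nat. K" ..
  from tail interpret N: prob_space N by (simp add: hidden_tail_chain_def)
  from tail have Y1 [measurable]: "Y 1 \<in> borel_measurable N" and lawY1: "distr N borel (Y 1) = K"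
    and ind: "N.indep_vars (\<lambda>_. borel) \<epsilon> {1..}" and law\<epsilon>: "\<And>s. s \<ge> 1 \<Longrightarrow> distr N borel (\<epsilon> s) = K"
    and rv: "indep_rv N borel (Y 1) (\<Pi>\<^sub>M s\<in>{1..}. borel) (\<lambda>\<omega>. \<lambda>s\<in>{1..}. \<epsilon> s \<omega>)"
    by (auto simp: hidden_tail_chain_def)
  have \<epsilon>: "\<epsilon> s \<in> borel_measurable N" if "s \<ge> 1" for s
    using ind that by (auto simp: N.indep_vars_def)
  let ?V = "\<lambda>\<omega>. \<lambda>i\<in>{1..t}. if i = 1 then Y 1 \<omega> else \<epsilon> (i - 1) \<omega>"
  have V: "?V \<in> N \<rightarrow>\<^sub>M PiM {1..t} (\<lambda>_. borel)"
  proof (rule measurable_restrict)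
    fix i assume "i \<in> {1..t}"
    then show "(\<lambda>\<omega>. if i = 1 then Y 1 \<omega> else \<epsilon> (i - 1) \<omega>) \<in> borel_measurable N"
      using \<epsilon>[of "i - 1"] Y1 by (cases "i = 1") auto
  qed
  show ?thesis
  proof (rule P.PiM_eqI)
    show "sets (distr N (PiM {1..t} (\<lambda>_. borel)) ?V) = sets (PiM {1..t} (\<lambda>_. K))"
      by (simp cong: sets_PiM_cong)
    fix A :: "nat \<Rightarrow> real set" assume "\<And>i. i \<in> {1..t} \<Longrightarrow> A i \<in> sets K"
    then have A: "\<And>i. i \<in> {1..t} \<Longrightarrow> A i \<in> sets borel" by simp
    let ?Ya = "Y 1 -` A 1 \<inter> space N"
    let ?\<epsilon>A = "{\<omega>\<in>space N. \<forall>s\<in>{1..<t}. \<epsilon> s \<omega> \<in> A (Suc s)}"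
    have *: "{1..t} = insert 1 (Suc ` {1..<t})"
      using t by (auto simp: image_Suc_atLeastLessThan)
    have "emeasure (distr N (PiM {1..t} (\<lambda>_. borel)) ?V) (Pi\<^sub>E {1..t} A) = emeasure N (?V -` Pi\<^sub>E {1..t} A \<inter> space N)"
      using A by (intro emeasure_distr[OF V] sets_PiM_I_finite) auto
    also have "?V -` Pi\<^sub>E {1..t} A \<inter> space N = ?Ya \<inter> ?\<epsilon>A"
    proof -
      have "?V \<omega> \<in> Pi\<^sub>E {1..t} A \<longleftrightarrow> Y 1 \<omega> \<in> A 1 \<and> (\<forall>s\<in>{1..<t}. \<epsilon> s \<omega> \<in> A (Suc s))" for \<omega>
      proof -
        have "?V \<omega> \<in> Pi\<^sub>E {1..t} A \<longleftrightarrow> (\<forall>i\<in>{1..t}. (if i = 1 then Y 1 \<omega> else \<epsilon> (i - 1) \<omega>) \<in> A i)"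
          by (auto simp: PiE_iff)
        also have "\<dots> \<longleftrightarrow> (\<forall>i\<in>insert 1 (Suc ` {1..<t}). (if i = 1 then Y 1 \<omega> else \<epsilon> (i - 1) \<omega>) \<in> A i)"
          using t by (subst *) simp
        also have "\<dots> \<longleftrightarrow> Y 1 \<omega> \<in> A 1 \<and> (\<forall>s\<in>{1..<t}. \<epsilon> s \<omega> \<in> A (Suc s))"
          by (auto simp del: image_Suc_atLeastLessThan)
        finally show ?thesis .
      qed
      then show ?thesis by auto
    qed
    also have "emeasure N (?Ya \<inter> ?\<epsilon>A) = ennreal (N.prob ?Ya * N.prob ?\<epsilon>A)"
    proof -
      \<comment> \<open>The hypothesis speaks of the infinite innovation vector, so the event on
        finitely many innovations is written as a cylinder event of that vector.\<close>
      let ?B = "{p \<in> space (\<Pi>\<^sub>M s\<in>{1..}. borel :: real measure). \<forall>s\<in>{1..<t}. p s \<in> A (Suc s)}"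
      have "?B \<in> sets (\<Pi>\<^sub>M s\<in>{1..}. borel)"
      proof (intro sets.sets_Collect_finite_All)
        fix s assume s: "s \<in> {1..<t}"
        then have [measurable]: "A (Suc s) \<in> sets borel" using A by auto
        have [measurable]: "(\<lambda>p. p s) \<in> (\<Pi>\<^sub>M s\<in>{1..}. borel :: real measure) \<rightarrow>\<^sub>M borel"
          using s by (intro measurable_component_singleton) auto
        show "{p \<in> space (\<Pi>\<^sub>M s\<in>{1..}. borel). p s \<in> A (Suc s)} \<in> sets (\<Pi>\<^sub>M s\<in>{1..}. borel)"
          by measurable
      qed simp
      moreover have "?\<epsilon>A = (\<lambda>\<omega>. \<lambda>s\<in>{1..}. \<epsilon> s \<omega>) -` ?B \<inter> space N"
        by (auto simp: space_PiM)
      moreover have "A 1 \<in> sets borel" using A t by simp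
      ultimately have "N.prob (?Ya \<inter> ?\<epsilon>A) = N.prob ?Ya * N.prob ?\<epsilon>A"
        using rv unfolding indep_rv_def by (intro N.indep_setD) blast+
      then show ?thesis by (simp add: N.emeasure_eq_measure)
    qed
    also have "N.prob ?Ya = measure K (A 1)"
      using A[of 1] t by (subst lawY1[symmetric], subst measure_distr[OF Y1]) auto
    also have "N.prob ?\<epsilon>A = (\<Prod>s\<in>{1..<t}. measure K (A (Suc s)))"
    \<comment> \<open>For \<open>t = 1\<close> no innovation occurs and the product is empty; the
      product rule for independent variables is applied to a nonempty index set.\<close>
    proof (cases "t = 1")
      case False
      then have ne: "{1..<t} \<noteq> {}" using t by auto
      have "?\<epsilon>A = (\<Inter>s\<in>{1..<t}. \<epsilon> s -` A (Suc s) \<inter> space N)" using ne by auto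
      also have "N.prob \<dots> = (\<Prod>s\<in>{1..<t}. N.prob (\<epsilon> s -` A (Suc s) \<inter> space N))"
        using ne A by (intro N.indep_varsD[OF ind]) auto
      also have "\<dots> = (\<Prod>s\<in>{1..<t}. measure K (A (Suc s)))"
      proof (rule prod.cong)
        fix s assume "s \<in> {1..<t}"
        then show "N.prob (\<epsilon> s -` A (Suc s) \<inter> space N) = measure K (A (Suc s))"
          using A[of "Suc s"] \<epsilon>[of s] by (subst law\<epsilon>[symmetric, of s], simp, subst measure_distr) auto
      qed simp
      finally show ?thesis .
    qed (simp add: N.prob_space)
    also have "ennreal (measure K (A 1) * (\<Prod>s\<in>{1..<t}. measure K (A (Suc s)))) = (\<Prod>i\<in>{1..t}. emeasure K (A i))"
    proof -
      have "(\<Prod>i\<in>{1..t}. emeasure K (A i)) = emeasure K (A 1) * (\<Prod>s\<in>{1..<t}. emeasure K (A (Suc s)))"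
        by (subst *, subst prod.insert) (auto simp: prod.reindex simp del: image_Suc_atLeastLessThan)
      then show ?thesis by (simp add: K.emeasure_eq_measure ennreal_mult prod_nonneg prod_ennreal)
    qed
    finally show "emeasure (distr N (PiM {1..t} (\<lambda>_. borel)) ?V) (Pi\<^sub>E {1..t} A) = (\<Prod>i\<in>{1..t}. emeasure K (A i))" .
  qed simp
qed

text \<open>The step into time \<open>Suc s\<close>. At \<open>s = 0\<close> it forgets the current
  state: time 0 carries the limiting exceedance, and the hidden tail chain starts afresh at time 1
  from its own noise.\<close>

definition tail_step :: "(real \<Rightarrow> real) \<Rightarrow> (nat \<Rightarrow> real \<Rightarrow> real) \<Rightarrow> (nat \<Rightarrow> real \<Rightarrow> real) \<Rightarrow>
    nat \<Rightarrow> real \<Rightarrow> real \<Rightarrow> real" where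
  "tail_step Q \<psi>a \<psi>b s y x = (if s = 0 then Q x else \<psi>a s y + \<psi>b s y * Q x)"

lemma measurable_tail_step:
  assumes "Q \<in> U \<rightarrow>\<^sub>M borel"
    and "\<And>s. s \<ge> 1 \<Longrightarrow> \<psi>a s \<in> borel_measurable borel" "\<And>s. s \<ge> 1 \<Longrightarrow> \<psi>b s \<in> borel_measurable borel"
  shows "(\<lambda>(y, x). tail_step Q \<psi>a \<psi>b s y x) \<in> borel \<Otimes>\<^sub>M U \<rightarrow>\<^sub>M borel"
proof (cases "s = 0")
  case False
  note [measurable] = assms(1) assms(2,3)[of s, OF False[unfolded neq0_conv Suc_le_eq[symmetric] One_nat_def[symmetric]]]
  show ?thesis using False by (simp add: tail_step_def)
next
  case True
  note [measurable] = assms(1)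
  show ?thesis using True by (simp add: tail_step_def)
qed

text \<open>Three moves: \<open>Y\<close> is the image of i.i.d. noise of law \<open>K\<close> under
  the recursion \<open>G\<close>; independence makes its joint law with \<open>E0\<close> a product;
  finally every factor is generated from a uniform coordinate by its quantile function.\<close>

lemma tail_law_eq_driven_path:
  assumes tail: "hidden_tail_chain N K \<psi>a \<psi>b Y \<epsilon>" and K: "real_distribution K" and t: "t \<ge> 1"
    and E0 [measurable]: "E0 \<in> borel_measurable N" and H: "real_distribution H" "distr N borel E0 = H"
    and indep: "indep_rv N borel E0 (\<Pi>\<^sub>M s\<in>{1..t}. borel) (\<lambda>\<omega>. \<lambda>s\<in>{1..t}. Y s \<omega>)"
    and \<psi>: "\<And>s. s \<ge> 1 \<Longrightarrow> \<psi>a s \<in> borel_measurable borel" "\<And>s. s \<ge> 1 \<Longrightarrow> \<psi>b s \<in> borel_measurable borel"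
  shows "distr N (PiM {..t} (\<lambda>_. borel)) (\<lambda>\<omega>. \<lambda>i\<in>{..t}. if i = 0 then E0 \<omega> else Y i \<omega>) =
    distr (PiM {..t} (\<lambda>_. uniform01)) (PiM {..t} (\<lambda>_. borel))
      (\<lambda>\<omega>. \<lambda>i\<in>{..t}. driven_path (quantile H) (tail_step (quantile K) \<psi>a \<psi>b) \<omega> i)"
proof -
  interpret K: real_distribution K by fact
  interpret H: real_distribution H by fact
  from tail interpret N: prob_space N by (simp add: hidden_tail_chain_def)
  from tail have Y: "\<And>s. s \<ge> 1 \<Longrightarrow> Y s \<in> borel_measurable N"
    and Y_rec: "\<And>s \<omega>. s \<ge> 1 \<Longrightarrow> \<omega> \<in> space N \<Longrightarrow> Y (s + 1) \<omega> = \<psi>a s (Y s \<omega>) + \<psi>b s (Y s \<omega>) * \<epsilon> s \<omega>"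
    by (auto simp: hidden_tail_chain_def)
  define D where "D i = (if i = 0 then H else K)" for i :: nat
  have D: "real_distribution (D i)" for i by (simp add: D_def H.real_distribution_axioms K.real_distribution_axioms)
  define G where "G = driven_path (\<lambda>x. x) (tail_step (\<lambda>x. x) \<psi>a \<psi>b)"
  \<comment> \<open>\<open>G\<close> ignores coordinate \<open>0\<close> of the noise beyond time \<open>0\<close>: \<open>E0\<close> is independent of \<open>Y\<close> but possibly
    not of \<open>(Y, \<epsilon>)\<close>, so \<open>Y\<close> has to be generated from \<open>(Y 1, \<epsilon>)\<close> alone before \<open>E0\<close> is joined to it.\<close>
  have G_cong: "G p i = G p' i" if "i \<ge> 1" "\<And>j. 1 \<le> j \<Longrightarrow> j \<le> i \<Longrightarrow> p j = p' j" for p p' i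
    using that
  proof (induction i rule: nat_induct_at_least)
    case base then show ?case by (simp add: G_def tail_step_def)
  next
    case (Suc i) then show ?case by (simp add: G_def tail_step_def)
  qed
  have G_meas: "(\<lambda>p. \<lambda>i\<in>{..t}. G p i) \<in> PiM {..t} (\<lambda>_. borel) \<rightarrow>\<^sub>M PiM {..t} (\<lambda>_. borel)"
    unfolding G_def by (intro measurable_restrict measurable_driven_path measurable_tail_step \<psi>) auto
  have ins: "{..t} = insert 0 {1..t}" by auto
  let ?upd = "\<lambda>(e, p). fun_upd p 0 e"
  have upd: "?upd \<in> borel \<Otimes>\<^sub>M PiM {1..t} (\<lambda>_. borel) \<rightarrow>\<^sub>M PiM {..t} (\<lambda>_. borel :: real measure)"
    unfolding ins by measurable
  let ?G1 = "\<lambda>p. \<lambda>i\<in>{1..t}. G p i"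
  have G1: "?G1 \<in> PiM {1..t} (\<lambda>_. borel) \<rightarrow>\<^sub>M PiM {1..t} (\<lambda>_. borel)"
  proof (rule measurable_restrict)
    fix i assume i: "i \<in> {1..t}"
    \<comment> \<open>The value 0 placed at coordinate 0 is a dummy: by \<open>G_cong\<close> the
      states from time 1 on are unaffected.\<close>
    have "(\<lambda>p. fun_upd p 0 0) \<in> PiM {1..t} (\<lambda>_. borel) \<rightarrow>\<^sub>M PiM {..t} (\<lambda>_. borel :: real measure)"
      unfolding ins by measurable
    moreover have "(\<lambda>p. G p i) \<in> PiM {..t} (\<lambda>_. borel) \<rightarrow>\<^sub>M borel"
      unfolding G_def by (intro measurable_driven_path measurable_tail_step \<psi>) (use i in auto)
    ultimately have "(\<lambda>p. G (fun_upd p 0 0) i) \<in> PiM {1..t} (\<lambda>_. borel) \<rightarrow>\<^sub>M borel"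
      by (rule measurable_compose)
    also have "(\<lambda>p. G (fun_upd p 0 0) i) = (\<lambda>p. G p i)"
      by (rule ext, rule G_cong) (use i in auto)
    finally show "(\<lambda>p. G p i) \<in> PiM {1..t} (\<lambda>_. borel) \<rightarrow>\<^sub>M borel" .
  qed
  let ?V = "\<lambda>\<omega>. \<lambda>i\<in>{1..t}. if i = 1 then Y 1 \<omega> else \<epsilon> (i - 1) \<omega>"
  have YG: "Y i \<omega> = G (?V \<omega>) i" if "1 \<le> i" "i \<le> t" "\<omega> \<in> space N" for i \<omega>
    using that
  proof (induction i rule: nat_induct_at_least)
    case base then show ?case by (simp add: G_def tail_step_def)
  next
    case (Suc i) then show ?case using Y_rec[of i \<omega>] by (simp add: G_def tail_step_def)
  qed
  have \<epsilon>: "\<epsilon> s \<in> borel_measurable N" if "s \<ge> 1" for s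
    using tail that by (auto simp: N.indep_vars_def hidden_tail_chain_def)
  have V: "?V \<in> N \<rightarrow>\<^sub>M PiM {1..t} (\<lambda>_. borel)"
  proof (rule measurable_restrict)
    fix i assume "i \<in> {1..t}"
    then show "(\<lambda>\<omega>. if i = 1 then Y 1 \<omega> else \<epsilon> (i - 1) \<omega>) \<in> borel_measurable N"
      using \<epsilon>[of "i - 1"] Y[of 1] by (cases "i = 1") auto
  qed
  let ?Yv = "\<lambda>\<omega>. \<lambda>i\<in>{1..t}. Y i \<omega>"
  have Yv [measurable]: "?Yv \<in> N \<rightarrow>\<^sub>M PiM {1..t} (\<lambda>_. borel)"
    by (intro measurable_restrict Y) simp
  have sK: "sets (PiM {1..t} (\<lambda>_. K)) = sets (PiM {1..t} (\<lambda>_. borel))"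
    by (simp cong: sets_PiM_cong)
  have pK: "prob_space (PiM {1..t} (\<lambda>_. K))" by (intro prob_space_PiM K.prob_space_axioms)
  interpret PK: prob_space "PiM {1..t} (\<lambda>_. K)" by (rule pK)
  have G1K: "?G1 \<in> PiM {1..t} (\<lambda>_. K) \<rightarrow>\<^sub>M PiM {1..t} (\<lambda>_. borel)"
    using G1 measurable_cong_sets[OF sK refl] by blast
  have sHK: "sets (H \<Otimes>\<^sub>M PiM {1..t} (\<lambda>_. K)) = sets (borel \<Otimes>\<^sub>M PiM {1..t} (\<lambda>_. borel))"
    by (intro sets_pair_measure_cong sK) simp
  have "distr N (PiM {1..t} (\<lambda>_. borel)) ?Yv = distr N (PiM {1..t} (\<lambda>_. borel)) (\<lambda>\<omega>. ?G1 (?V \<omega>))"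
    by (rule distr_cong) (auto simp: YG fun_eq_iff restrict_def)
  also have "\<dots> = distr (distr N (PiM {1..t} (\<lambda>_. borel)) ?V) (PiM {1..t} (\<lambda>_. borel)) ?G1"
    by (subst distr_distr[OF G1 V]) (simp add: comp_def)
  also have "distr N (PiM {1..t} (\<lambda>_. borel)) ?V = PiM {1..t} (\<lambda>_. K)"
    by (rule hidden_tail_chain_noise_law[OF tail K t])
  finally have lawY: "distr N (PiM {1..t} (\<lambda>_. borel)) ?Yv = distr (PiM {1..t} (\<lambda>_. K)) (PiM {1..t} (\<lambda>_. borel)) ?G1" .
  interpret DY: prob_space "distr (PiM {1..t} (\<lambda>_. K)) (PiM {1..t} (\<lambda>_. borel)) ?G1"
    by (rule PK.prob_space_distr[OF G1K])
  have "distr N (borel \<Otimes>\<^sub>M PiM {1..t} (\<lambda>_. borel)) (\<lambda>\<omega>. (E0 \<omega>, ?Yv \<omega>)) =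
      H \<Otimes>\<^sub>M distr (PiM {1..t} (\<lambda>_. K)) (PiM {1..t} (\<lambda>_. borel)) ?G1"
    using distr_Pair_indep_rv[OF N.prob_space_axioms indep] by (simp only: H(2) lawY)
  also have "\<dots> = distr H borel (\<lambda>x. x) \<Otimes>\<^sub>M distr (PiM {1..t} (\<lambda>_. K)) (PiM {1..t} (\<lambda>_. borel)) ?G1"
    by (simp add: distr_id2)
  also have "\<dots> = distr (H \<Otimes>\<^sub>M PiM {1..t} (\<lambda>_. K)) (borel \<Otimes>\<^sub>M PiM {1..t} (\<lambda>_. borel)) (\<lambda>(e, p). (e, ?G1 p))"
    by (rule pair_measure_distr[OF _ G1K]) (simp, unfold_locales)
  finally have joint: "distr N (borel \<Otimes>\<^sub>M PiM {1..t} (\<lambda>_. borel)) (\<lambda>\<omega>. (E0 \<omega>, ?Yv \<omega>)) =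
    distr (H \<Otimes>\<^sub>M PiM {1..t} (\<lambda>_. K)) (borel \<Otimes>\<^sub>M PiM {1..t} (\<lambda>_. borel)) (\<lambda>(e, p). (e, ?G1 p))" .
  have eG1: "(\<lambda>(e, p). (e, ?G1 p)) \<in> H \<Otimes>\<^sub>M PiM {1..t} (\<lambda>_. K) \<rightarrow>\<^sub>M borel \<Otimes>\<^sub>M PiM {1..t} (\<lambda>_. borel)"
    using G1K by measurable
  have updHK: "?upd \<in> H \<Otimes>\<^sub>M PiM {1..t} (\<lambda>_. K) \<rightarrow>\<^sub>M PiM {..t} (\<lambda>_. borel)"
    using upd measurable_cong_sets[OF sHK refl] by blast
  have "distr N (PiM {..t} (\<lambda>_. borel)) (\<lambda>\<omega>. \<lambda>i\<in>{..t}. if i = 0 then E0 \<omega> else Y i \<omega>) =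
    distr (distr N (borel \<Otimes>\<^sub>M PiM {1..t} (\<lambda>_. borel)) (\<lambda>\<omega>. (E0 \<omega>, ?Yv \<omega>))) (PiM {..t} (\<lambda>_. borel)) ?upd"
    by (subst distr_distr[OF upd measurable_Pair[OF E0 Yv]])
      (auto simp: comp_def fun_eq_iff intro!: distr_cong)
  also have "\<dots> = distr (H \<Otimes>\<^sub>M PiM {1..t} (\<lambda>_. K)) (PiM {..t} (\<lambda>_. borel)) (\<lambda>z. ?upd ((\<lambda>(e, p). (e, ?G1 p)) z))"
    unfolding joint by (subst distr_distr[OF upd eG1]) (simp add: comp_def)
  \<comment> \<open>\<open>G\<close> copies coordinate 0 and agrees with \<open>?G1\<close> on the
    others, so the recursion may be applied after \<open>E0\<close> has been glued on.\<close>
  also have "\<dots> = distr (H \<Otimes>\<^sub>M PiM {1..t} (\<lambda>_. K)) (PiM {..t} (\<lambda>_. borel)) (\<lambda>z. \<lambda>i\<in>{..t}. G (?upd z) i)"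
  proof (rule distr_cong)
    fix z assume "z \<in> space (H \<Otimes>\<^sub>M PiM {1..t} (\<lambda>_. K))"
    obtain e p where z: "z = (e, p)" by (cases z)
    have "G (fun_upd p 0 e) i = G p i" if "i \<ge> 1" for i by (rule G_cong) (use that in auto)
    moreover have "G (fun_upd p 0 e) 0 = e" by (simp add: G_def)
    ultimately show "?upd ((\<lambda>(e, p). (e, ?G1 p)) z) = (\<lambda>i\<in>{..t}. G (?upd z) i)"
      by (auto simp: z fun_eq_iff Suc_le_eq)
  qed auto
  also have "\<dots> = distr (distr (H \<Otimes>\<^sub>M PiM {1..t} (\<lambda>_. K)) (PiM {..t} (\<lambda>_. borel)) ?upd) (PiM {..t} (\<lambda>_. borel)) (\<lambda>p. \<lambda>i\<in>{..t}. G p i)"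
    by (subst distr_distr[OF G_meas updHK]) (simp add: comp_def)
  also have "distr (H \<Otimes>\<^sub>M PiM {1..t} (\<lambda>_. K)) (PiM {..t} (\<lambda>_. borel)) ?upd = PiM {..t} D"
  proof -
    have "PiM {1..t} (\<lambda>_. K) = PiM {1..t} D" by (rule PiM_cong) (auto simp: D_def)
    moreover have "distr (D 0 \<Otimes>\<^sub>M PiM {1..t} D) (PiM (insert 0 {1..t}) D) ?upd = PiM (insert 0 {1..t}) D"
      by (rule distr_pair_PiM_eq_PiM) (auto simp: D_def H.prob_space_axioms K.prob_space_axioms)
    moreover have "sets (PiM {..t} (\<lambda>_. borel)) = sets (PiM {..t} D)"
      by (rule sets_PiM_cong) (auto simp: D_def)
    ultimately show ?thesis unfolding ins[symmetric] by (simp add: D_def cong: distr_cong)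
  qed
  also have "PiM {..t} D = distr (PiM {..t} (\<lambda>_. uniform01)) (PiM {..t} (\<lambda>_. borel)) (\<lambda>\<omega>. \<lambda>i\<in>{..t}. quantile (D i) (\<omega> i))"
    by (rule distr_quantile_PiM[symmetric]) (auto intro: D)
  also have "distr \<dots> (PiM {..t} (\<lambda>_. borel)) (\<lambda>p. \<lambda>i\<in>{..t}. G p i) =
    distr (PiM {..t} (\<lambda>_. uniform01)) (PiM {..t} (\<lambda>_. borel)) (\<lambda>\<omega>. \<lambda>i\<in>{..t}. G (\<lambda>i\<in>{..t}. quantile (D i) (\<omega> i)) i)"
  proof -
    note [measurable] = measurable_quantile[OF D]
    have "(\<lambda>\<omega>. \<lambda>i\<in>{..t}. quantile (D i) (\<omega> i)) \<in> PiM {..t} (\<lambda>_. uniform01) \<rightarrow>\<^sub>M PiM {..t} (\<lambda>_. borel)" by measurable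
    then show ?thesis by (subst distr_distr[OF G_meas]) (simp_all add: comp_def)
  qed
  \<comment> \<open>Feeding quantiles into the recursion with identity transforms is the same as
    building the quantile functions into the recursion.\<close>
  also have "\<dots> = distr (PiM {..t} (\<lambda>_. uniform01)) (PiM {..t} (\<lambda>_. borel))
      (\<lambda>\<omega>. \<lambda>i\<in>{..t}. driven_path (quantile H) (tail_step (quantile K) \<psi>a \<psi>b) \<omega> i)"
  proof (intro distr_cong refl restrict_ext)
    fix \<omega> :: "nat \<Rightarrow> real" and i assume "i \<in> {..t}"
    then have "i \<le> t" by simp
    then show "G (\<lambda>i\<in>{..t}. quantile (D i) (\<omega> i)) i = driven_path (quantile H) (tail_step (quantile K) \<psi>a \<psi>b) \<omega> i"
      by (induction i) (auto simp: G_def D_def tail_step_def)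
  qed
  finally show ?thesis .
qed

section \<open>Convergence of the coupled paths\<close>

text \<open>A negative quantile would be a point with distribution function at least
  \<open>\<omega> > 0\<close>, although no mass lies below 0. This keeps the coupled paths starting
  at or above \<open>u\<close>.\<close>

lemma quantile_nonneg:
  assumes \<mu>: "real_distribution \<mu>" and nn: "AE x in \<mu>. 0 \<le> x" and \<omega>: "0 < \<omega>" "\<omega> < 1"
  shows "0 \<le> quantile \<mu> \<omega>"
proof (rule ccontr)
  interpret real_distribution \<mu> by fact
  assume "\<not> 0 \<le> quantile \<mu> \<omega>"
  then have neg: "quantile \<mu> \<omega> < 0" by simp
  have "\<omega> \<le> cdf \<mu> (quantile \<mu> \<omega>)" using quantile_le_iff[OF \<mu> \<omega>, of "quantile \<mu> \<omega>"] by simp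
  also have "\<dots> = 0"
    unfolding cdf_def using nn neg by (subst prob_eq_0) (auto elim: eventually_mono)
  finally show False using \<omega> by simp
qed

text \<open>Makes the test functions, continuous for the product topology, measurable for the
  product sigma-algebra, so that their integrals can be transported along
  \<open>distr\<close>.\<close>

lemma half_space_indicator_borel_measurable:
  assumes g: "continuous_map (half_space t) euclideanreal g"
  shows "(\<lambda>p. indicator (topspace (half_space t)) p *\<^sub>R g p) \<in> borel_measurable (PiM {..t} (\<lambda>_. borel))"
proof -
  let ?P = "PiM {..t} (\<lambda>_. borel :: real measure)"
  \<comment> \<open>The retraction \<open>c\<close> onto the half-space extends \<open>g\<close> to a continuous function on the type
    \<open>nat \<Rightarrow> real\<close>, where Borel sets are known to coincide with product-measurable ones.\<close>
  define c :: "(nat \<Rightarrow> real) \<Rightarrow> nat \<Rightarrow> real" where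
    "c p = (\<lambda>i\<in>{..t}. if i = 0 then max 0 (p 0) else p i)" for p
  have "continuous_map euclidean (half_space t) c"
    unfolding half_space_def continuous_map_componentwise
  proof safe
    fix i
    have "continuous_map euclidean euclideanreal (\<lambda>p::nat \<Rightarrow> real. c p i)" if "i \<le> t"
      using that by (auto simp: c_def intro!: continuous_intros continuous_on_product_coordinates)
    moreover assume "i \<le> t"
    ultimately show "continuous_map euclidean (if i = 0 then top_of_set {0..} else euclideanreal) (\<lambda>p. c p i)"
      by (auto simp: continuous_map_in_subtopology c_def)
  qed (auto simp: c_def)
  from continuous_map_compose[OF this g] have "continuous_on UNIV (\<lambda>p. g (c p))"
    by (simp add: comp_def)
  then have gc: "(\<lambda>p. g (c p)) \<in> borel_measurable borel"
    by (rule borel_measurable_continuous_onI)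
  have "(\<lambda>p. p) \<in> ?P \<rightarrow>\<^sub>M borel"
  proof (rule measurable_coordinatewise_then_product)
    fix i
    show "(\<lambda>p. p i) \<in> borel_measurable ?P"
    proof (cases "i \<le> t")
      case False
      \<comment> \<open>Points are extensional: beyond \<open>t\<close> every coordinate is the
        constant \<open>undefined\<close>.\<close>
      then have "(\<lambda>p. p i) \<in> borel_measurable ?P \<longleftrightarrow> (\<lambda>_. undefined :: real) \<in> borel_measurable ?P"
        by (intro measurable_cong) (auto simp: space_PiM PiE_def extensional_def)
      then show ?thesis by simp
    qed simp
  qed
  from measurable_compose[OF this gc] have [measurable]: "(\<lambda>p. g (c p)) \<in> borel_measurable ?P" .
  have [measurable]: "(\<lambda>p. p 0) \<in> borel_measurable ?P" by simp
  have "(\<lambda>p. indicator {0..} (p 0) *\<^sub>R g (c p)) \<in> borel_measurable ?P"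
    by measurable
  also have "?this \<longleftrightarrow> ?thesis"
  proof (rule measurable_cong)
    fix p assume "p \<in> space ?P"
    then have "p \<in> topspace (half_space t) \<longleftrightarrow> p 0 \<ge> 0"
      by (auto simp: half_space_def space_PiM PiE_iff)
    moreover have "c p = p" if "p 0 \<ge> 0"
      using \<open>p \<in> space ?P\<close> that by (auto simp: c_def space_PiM PiE_def extensional_def fun_eq_iff)
    ultimately show "indicator {0..} (p 0) *\<^sub>R g (c p) = indicator (topspace (half_space t)) p *\<^sub>R g p"
      by (simp split: split_indicator)
  qed
  finally show ?thesis .
qed

text \<open>Here \<open>e s w\<close> is the noise of step \<open>s\<close> in state
  \<open>w\<close>. Induction on \<open>s\<close>: with \<open>z\<close> the normalised state at
  time \<open>s\<close>, the next one is
  \<open>(a (x u s) - as (Suc s) (v u)) / bs (Suc s) (v u)\<close> plus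
  \<open>b (x u s) / bs (Suc s) (v u)\<close> times the noise. The remainder conditions give the
  limits of both coefficients.\<close>

lemma normalized_path_tendsto:
  fixes x :: "'i \<Rightarrow> nat \<Rightarrow> real" and e :: "nat \<Rightarrow> real \<Rightarrow> real"
  assumes A2a: "assumption_A2a a b as bs" and A2b: "assumption_A2b a b as bs \<psi>a \<psi>b"
    and b: "\<And>v. b v > 0"
    and x0: "filterlim (\<lambda>u. x u 0) at_top F"
    and step: "\<And>u s. x u (Suc s) = a (x u s) + b (x u s) * e (Suc s) (x u s)"
    and e: "\<And>s. s \<ge> 1 \<Longrightarrow> s \<le> t \<Longrightarrow> (e s \<longlongrightarrow> e' s) at_top"
    and y1: "y 1 = e' 1" and y: "\<And>s. s \<ge> 1 \<Longrightarrow> y (Suc s) = \<psi>a s (y s) + \<psi>b s (y s) * e' (Suc s)"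
    and s: "s \<ge> 1" "s \<le> t"
  shows "((\<lambda>u. (x u s - as s (x u 0)) / bs s (x u 0)) \<longlongrightarrow> y s) F"
  using s
proof (induction s rule: nat_induct_at_least)
  case base
  have "as 1 = a" "bs 1 = b" using A2a by (auto simp: assumption_A2a_def)
  moreover have "((\<lambda>u. e 1 (x u 0)) \<longlongrightarrow> e' 1) F"
    using filterlim_compose[OF e[of 1] x0] base by simp
  moreover have "b v \<noteq> 0" for v using b[of v] by simp
  ultimately show ?case using step[of _ 0] y1 by simp
next
  case (Suc s)
  define v where "v u = x u 0" for u
  define z where "z u = (x u s - as s (v u)) / bs s (v u)" for u
  define m where "m = y s"
  have v: "filterlim v at_top F" using x0 by (simp add: v_def[abs_def])
  have z: "(z \<longlongrightarrow> m) F" using Suc by (simp add: z_def[abs_def] v_def m_def)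
  have bs: "bs r w > 0" if "r \<ge> 1" for r w
    using A2a b that by (cases "r = 1") (auto simp: assumption_A2a_def)
  have xz: "x u s = as s (v u) + bs s (v u) * z u" for u
    using bs[OF Suc(1), of "v u"] by (simp add: z_def)
  have z_near: "eventually (\<lambda>u. z u \<in> cball m 1) F"
    using tendstoD[OF z, of 1] by (auto elim: eventually_mono simp: dist_commute)
  \<comment> \<open>Eventually \<open>z\<close> is at least \<open>m - 1\<close>, so the state
    dominates the norming line at this fixed point, which diverges by Assumption A2(a). Hence the
    limit of \<open>e\<close> at infinity applies along the moving state.\<close>
  have xs: "filterlim (\<lambda>u. x u s) at_top F"
  proof (rule filterlim_at_top_mono)
    have "filterlim (\<lambda>w. as s w + bs s w * (m - 1)) at_top at_top"
      using A2a Suc(1) by (simp add: assumption_A2a_def)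
    from filterlim_compose[OF this v]
    show "filterlim (\<lambda>u. as s (v u) + bs s (v u) * (m - 1)) at_top F" .
    show "eventually (\<lambda>u. as s (v u) + bs s (v u) * (m - 1) \<le> x u s) F"
      using z_near
    proof eventually_elim
      case (elim u)
      then have "m - 1 \<le> z u" by (auto simp: dist_real_def)
      then show ?case using bs[OF Suc(1), of "v u"] by (simp add: xz)
    qed
  qed
  \<comment> \<open>Uniformity on the compact ball around \<open>m\<close> allows the remainders to
    be evaluated at the moving point \<open>z u\<close>.\<close>
  have unif: "((\<lambda>u. r (v u) (z u)) \<longlongrightarrow> 0) F"
    if r: "uniform_limit (cball m 1) r (\<lambda>_. 0) at_top" for r :: "real \<Rightarrow> real \<Rightarrow> real"
  proof (rule tendstoI)
    fix \<delta> :: real assume "\<delta> > 0"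
    then have "\<forall>\<^sub>F w in at_top. \<forall>z\<in>cball m 1. dist (r w z) 0 < \<delta>"
      using r by (auto simp: uniform_limit_iff)
    from eventually_compose_filterlim[OF this v] z_near
    show "\<forall>\<^sub>F u in F. dist (r (v u) (z u)) 0 < \<delta>" by eventually_elim blast
  qed
  let ?t = "Suc s"
  let ?B = "\<lambda>u. b (x u s) / bs ?t (v u)"
  have \<psi>a: "isCont (\<psi>a s) m" and \<psi>b: "isCont (\<psi>b s) m" and pos: "\<And>x. \<psi>b s x > 0"
    using A2b Suc(1) by (auto simp: assumption_A2b_def continuous_on_eq_continuous_at)
  have "((\<lambda>u. remainder_b b as bs \<psi>b s (v u) (z u)) \<longlongrightarrow> 0) F"
    by (rule unif) (use A2b Suc(1) in \<open>auto simp: assumption_A2b_def\<close>)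
  from tendsto_diff[OF tendsto_const[of 1] this]
  have "((\<lambda>u. bs ?t (v u) * \<psi>b s (z u) / b (x u s)) \<longlongrightarrow> 1) F"
    by (simp add: remainder_b_def xz)
  \<comment> \<open>Dividing \<open>\<psi>b s (z u)\<close> by the previous quotient cancels the
    positive factor \<open>\<psi>b s (z u)\<close> and leaves \<open>?B u\<close>.\<close>
  from tendsto_divide[OF isCont_tendsto_compose[OF \<psi>b z] this]
  have B: "(?B \<longlongrightarrow> \<psi>b s m) F"
    using pos b bs[of ?t] by (simp add: field_simps less_imp_neq[OF pos, symmetric] less_imp_neq[OF bs, symmetric])
  have "((\<lambda>u. remainder_a a b as bs \<psi>a s (v u) (z u)) \<longlongrightarrow> 0) F"
    by (rule unif) (use A2b Suc(1) in \<open>auto simp: assumption_A2b_def\<close>)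
  \<comment> \<open>Solving the definition of \<open>remainder_a\<close> for the centred shift gives
    \<open>\<psi>a s (z u)\<close> minus the remainder times \<open>?B u\<close>; the last product
    vanishes because \<open>?B\<close> converges.\<close>
  from tendsto_diff[OF isCont_tendsto_compose[OF \<psi>a z] tendsto_mult[OF this B]]
  have "((\<lambda>u. \<psi>a s (z u) - remainder_a a b as bs \<psi>a s (v u) (z u) * ?B u) \<longlongrightarrow> \<psi>a s m) F"
    by simp
  also have "(\<lambda>u. \<psi>a s (z u) - remainder_a a b as bs \<psi>a s (v u) (z u) * ?B u) =
    (\<lambda>u. (a (x u s) - as ?t (v u)) / bs ?t (v u))"
  proof
    fix u
    have "b (x u s) > 0" "bs ?t (v u) > 0" using b bs[of ?t] by auto
    moreover have "remainder_a a b as bs \<psi>a s (v u) (z u) =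
      (as ?t (v u) - a (x u s) + bs ?t (v u) * \<psi>a s (z u)) / b (x u s)"
      by (simp add: remainder_a_def xz)
    ultimately show "\<psi>a s (z u) - remainder_a a b as bs \<psi>a s (v u) (z u) * ?B u =
      (a (x u s) - as ?t (v u)) / bs ?t (v u)"
      by (simp add: field_simps)
  qed
  finally have A: "((\<lambda>u. (a (x u s) - as ?t (v u)) / bs ?t (v u)) \<longlongrightarrow> \<psi>a s m) F" .
  have "((\<lambda>u. e ?t (x u s)) \<longlongrightarrow> e' ?t) F"
    using filterlim_compose[OF e[of ?t] xs] Suc.prems by simp
  from tendsto_add[OF A tendsto_mult[OF B this]]
  show ?case
    using y[OF Suc(1)] by (simp add: m_def v_def step add_divide_distrib diff_divide_distrib algebra_simps)
qed

theorem theorem1: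
  fixes M :: "'w measure" and X :: "nat \<Rightarrow> 'w \<Rightarrow> real"
    and F\<^sub>0 H\<^sub>0 K :: "real measure" and \<pi> :: "real \<Rightarrow> real measure"
    and \<sigma> a b :: "real \<Rightarrow> real"
    and as bs \<psi>a \<psi>b :: "nat \<Rightarrow> real \<Rightarrow> real"
    and t :: nat
    and N :: "'n measure" and E\<^sub>0 :: "'n \<Rightarrow> real" and Y \<epsilon> :: "nat \<Rightarrow> 'n \<Rightarrow> real"
  assumes chain: "homogeneous_markov_chain M X F\<^sub>0 \<pi>"
    and F0: "assumption_F0 F\<^sub>0 H\<^sub>0 \<sigma>"
    and A1: "assumption_A1 \<pi> a b K"
    and A2a: "assumption_A2a a b as bs"
    and A2b: "assumption_A2b a b as bs \<psi>a \<psi>b"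
    and t: "t \<ge> 1"
    and tail_chain: "hidden_tail_chain N K \<psi>a \<psi>b Y \<epsilon>"
    and E0: "E\<^sub>0 \<in> borel_measurable N" "distr N borel E\<^sub>0 = H\<^sub>0"
    and indep: "indep_rv N
                  borel E\<^sub>0
                  (\<Pi>\<^sub>M s\<in>{1..t}. borel) (\<lambda>\<omega>. \<lambda>s\<in>{1..t}. Y s \<omega>)"
  shows "weak_conv_on (half_space t)
           (\<lambda>u. distr (uniform_measure M {\<omega>\<in>space M. X 0 \<omega> > u})
                  (\<Pi>\<^sub>M i\<in>{..t}. borel) (normalized_chain X \<sigma> as bs t u))
           (distr N (\<Pi>\<^sub>M i\<in>{..t}. borel) (\<lambda>\<omega>. \<lambda>i\<in>{..t}. if i = 0 then E\<^sub>0 \<omega> else Y i \<omega>))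
           at_top"
proof -
  from chain have M: "prob_space M" and X [measurable]: "\<And>i. X i \<in> borel_measurable M"
    and lawX0: "distr M borel (X 0) = F\<^sub>0" and \<pi> [measurable]: "\<pi> \<in> borel \<rightarrow>\<^sub>M prob_algebra borel"
    by (auto simp: homogeneous_markov_chain_def)
  interpret M: prob_space M by fact
  from F0 have up: "upper_endpoint F\<^sub>0 = \<infinity>" and H: "real_distribution H\<^sub>0" and H_nn: "measure H\<^sub>0 {0..} = 1"
    and \<sigma>_meas [measurable]: "\<sigma> \<in> borel_measurable borel" and \<sigma>: "\<And>u. \<sigma> u > 0"
    and wF: "weak_conv_on (top_of_set {0..})
       (\<lambda>u. distr (uniform_measure F\<^sub>0 {u<..}) borel (\<lambda>x. (x - u) / \<sigma> u)) H\<^sub>0 at_top"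
    by (auto simp: assumption_F0_def)
  from A1 have [measurable]: "a \<in> borel_measurable borel" "b \<in> borel_measurable borel"
    and b: "\<And>v. b v > 0" and K: "real_distribution K"
    and wK: "weak_conv_on euclideanreal (\<lambda>v. distr (\<pi> v) borel (\<lambda>z. (z - a v) / b v)) K at_top"
    by (auto simp: assumption_A1_def)
  have as_meas: "as s \<in> borel_measurable borel" and bs_meas: "bs s \<in> borel_measurable borel" if "s \<ge> 1" for s
    using A1 A2a that by (cases "s = 1"; auto simp: assumption_A1_def assumption_A2a_def)+
  have \<psi>: "\<psi>a s \<in> borel_measurable borel" "\<psi>b s \<in> borel_measurable borel" if "s \<ge> 1" for s
    using A2b that by (auto simp: assumption_A2b_def intro: borel_measurable_continuous_onI)
  interpret K: real_distribution K by fact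
  interpret H: real_distribution H\<^sub>0 by fact
  interpret un: prob_space uniform01 by (rule prob_space_uniform01)
  have F: "real_distribution F\<^sub>0"
    unfolding lawX0[symmetric] by (rule M.real_distribution_distr) simp
  interpret F: real_distribution F\<^sub>0 by fact

  \<comment> \<open>Normalised kernel and normalised exceedance laws\<close>
  define \<kappa> where "\<kappa> v = distr (\<pi> v) borel (\<lambda>z. (z - a v) / b v)" for v
  have \<kappa>_meas: "\<kappa> \<in> borel \<rightarrow>\<^sub>M prob_algebra borel"
    unfolding \<kappa>_def[abs_def] by measurable
  have \<kappa>: "real_distribution (\<kappa> v)" for v
    using measurable_space[OF \<kappa>_meas, of v]
    by (auto simp: space_prob_algebra real_distribution_def real_distribution_axioms_def)
  define \<mu> where "\<mu> u = distr (uniform_measure F\<^sub>0 {u<..}) borel (\<lambda>x. (x - u) / \<sigma> u)" for u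
  have cond: "prob_space (uniform_measure F\<^sub>0 {u<..})" for u
    by (rule prob_space_uniform_measure[OF emeasure_tail_pos[OF F up]]) (simp add: F.emeasure_eq_measure)
  have \<mu>: "real_distribution (\<mu> u)" for u
    unfolding \<mu>_def by (rule prob_space.real_distribution_distr[OF cond]) simp
  have \<mu>_nn: "AE x in \<mu> u. 0 \<le> x" for u
  proof -
    have "AE x in uniform_measure F\<^sub>0 {u<..}. u < x"
      by (rule AE_uniform_measureI) auto
    then show ?thesis
      unfolding \<mu>_def using \<sigma>[of u] by (subst AE_distr_iff) (auto elim!: eventually_mono)
  qed
  have H_AE: "AE x in H\<^sub>0. 0 \<le> x" using H.prob_eq_1[of "{0..}"] H_nn by simp

  \<comment> \<open>Coupled paths on one space of uniform noise\<close>
  define f where "f u x = u + \<sigma> u * quantile (\<mu> u) x" for u x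
  \<comment> \<open>The update has a time index to fit \<open>driven_path\<close>, but its value is
    the same for every \<open>s\<close>: the chain is homogeneous.\<close>
  define q where "q s w x = a w + b w * quantile (\<kappa> w) x" for s :: nat and w x
  have f [measurable]: "f u \<in> uniform01 \<rightarrow>\<^sub>M borel" for u
    unfolding f_def[abs_def] using measurable_quantile[OF \<mu>] by measurable
  have q [measurable]: "(\<lambda>(w, x). q s w x) \<in> borel \<Otimes>\<^sub>M uniform01 \<rightarrow>\<^sub>M borel" for s
    unfolding q_def using measurable_quantile_kernel[OF \<kappa>_meas] by measurable
  define x where "x u \<omega> = driven_path (f u) q \<omega>" for u \<omega>
  define y where "y \<omega> = driven_path (quantile H\<^sub>0) (tail_step (quantile K) \<psi>a \<psi>b) \<omega>" for \<omega>
  define W where "W = (\<Pi>\<^sub>M i\<in>{..t}. uniform01)"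
  let ?P = "\<Pi>\<^sub>M i\<in>{..t}. (borel :: real measure)"
  interpret W: prob_space W unfolding W_def by (intro prob_space_PiM prob_space_uniform01)
  have x_meas: "(\<lambda>\<omega>. \<lambda>i\<in>{..t}. x u \<omega> i) \<in> W \<rightarrow>\<^sub>M ?P" for u
    unfolding x_def W_def by (intro measurable_restrict measurable_driven_path f q) auto
  have y_meas: "(\<lambda>\<omega>. \<lambda>i\<in>{..t}. y \<omega> i) \<in> W \<rightarrow>\<^sub>M ?P"
    unfolding y_def W_def
    by (intro measurable_restrict measurable_driven_path measurable_quantile measurable_tail_step \<psi> H K) auto

  \<comment> \<open>Law of the conditioned chain as the law of a coupled path\<close>
  have law_x: "distr (uniform_measure M {\<omega>\<in>space M. X 0 \<omega> > u}) ?P (\<lambda>\<omega>. \<lambda>i\<in>{..t}. X i \<omega>) =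
      distr W ?P (\<lambda>\<omega>. \<lambda>i\<in>{..t}. x u \<omega> i)" for u
    unfolding W_def x_def
  proof (rule distr_eq_distr_driven_path[OF prob_space_uniform01 _ _ f q])
    let ?M = "uniform_measure M {\<omega>\<in>space M. X 0 \<omega> > u}"
    have "emeasure M {\<omega>\<in>space M. X 0 \<omega> > u} = emeasure F\<^sub>0 {u<..}"
      unfolding lawX0[symmetric] by (subst emeasure_distr) (auto intro!: arg_cong[where f="emeasure M"])
    then show "prob_space ?M"
      using emeasure_tail_pos[OF F up] by (intro prob_space_uniform_measure) (auto simp: F.emeasure_eq_measure)
    show "X i \<in> borel_measurable ?M" for i by simp
    have "distr ?M borel (X 0) = uniform_measure F\<^sub>0 {u<..}"
      using distr_uniform_measure_vimage[of "X 0" M borel "{u<..}"] lawX0 by simp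
    also have "\<dots> = distr (\<mu> u) borel (\<lambda>x. u + \<sigma> u * x)"
      unfolding \<mu>_def using \<sigma>[of u]
      by (subst distr_distr) (auto simp: comp_def less_imp_neq[OF \<sigma>, symmetric] intro!: distr_id2[symmetric])
    also have "\<dots> = distr uniform01 borel (f u)"
      by (subst distr_quantile[OF \<mu>, symmetric], subst distr_distr)
        (auto simp: comp_def f_def[abs_def] intro: measurable_quantile[OF \<mu>])
    finally show "distr ?M borel (X 0) = distr uniform01 borel (f u)" .
    fix s and A :: "nat \<Rightarrow> real set" assume A: "\<And>i. i \<le> Suc s \<Longrightarrow> A i \<in> sets borel"
    \<comment> \<open>The affine map undoes the normalisation in \<open>\<kappa> w\<close>, so one
      uniform variable realises a transition from \<open>w\<close> under
      \<open>\<pi>\<close>.\<close>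
    have law_q: "distr uniform01 borel (q s w) = \<pi> w" for w
    proof -
      have [simp]: "sets (\<pi> w) = sets borel"
        using measurable_space[OF \<pi>, of w] by (simp add: space_prob_algebra)
      have [measurable]: "g \<in> \<pi> w \<rightarrow>\<^sub>M borel" if "g \<in> borel \<rightarrow>\<^sub>M borel" for g :: "real \<Rightarrow> real"
        using that by (simp cong: measurable_cong_sets)
      have "distr uniform01 borel (q s w) =
        distr (distr uniform01 borel (quantile (\<kappa> w))) borel (\<lambda>x. a w + b w * x)"
        by (subst distr_distr[OF _ measurable_quantile[OF \<kappa>]]) (simp_all add: comp_def q_def[abs_def])
      also have "\<dots> = distr (\<kappa> w) borel (\<lambda>x. a w + b w * x)"
        by (simp only: distr_quantile[OF \<kappa>])
      also have "\<dots> = \<pi> w"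
        unfolding \<kappa>_def using b[of w]
        by (subst distr_distr) (auto simp: comp_def less_imp_neq[OF b, symmetric] intro!: distr_id2)
      finally show ?thesis .
    qed
    have "(\<integral>\<^sup>+x. indicator (A (Suc s)) (q s w x) \<partial>uniform01) = emeasure (\<pi> w) (A (Suc s))" for w
    proof -
      have [measurable]: "A (Suc s) \<in> sets borel" using A by simp
      have m: "q s w \<in> uniform01 \<rightarrow>\<^sub>M borel" using measurable_Pair2[OF q[of s], of w] by simp
      have "(\<integral>\<^sup>+x. indicator (A (Suc s)) (q s w x) \<partial>uniform01) =
        (\<integral>\<^sup>+z. indicator (A (Suc s)) z \<partial>distr uniform01 borel (q s w))"
        by (rule nn_integral_distr[OF m, symmetric]) simp
      then show ?thesis by (simp add: law_q[of w, symmetric])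
    qed
    then show "emeasure ?M {\<omega>\<in>space ?M. \<forall>i\<le>Suc s. X i \<omega> \<in> A i} =
      (\<integral>\<^sup>+\<omega>. indicator {\<omega>\<in>space ?M. \<forall>i\<le>s. X i \<omega> \<in> A i} \<omega> *
        (\<integral>\<^sup>+x. indicator (A (Suc s)) (q s (X s \<omega>) x) \<partial>uniform01) \<partial>?M)"
      using conditioned_markov_chain_box_step[OF chain A, where u = u] by (simp only: space_uniform_measure)
  qed

  \<comment> \<open>Normalisation of the paths and transfer of the laws\<close>
  define T where "T u p = (\<lambda>i\<in>{..t}. if i = 0 then (p 0 - u) / \<sigma> u else (p i - as i (p 0)) / bs i (p 0))"
    for u and p :: "nat \<Rightarrow> real"
  have T: "T u \<in> ?P \<rightarrow>\<^sub>M ?P" for u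
    unfolding T_def
  proof (rule measurable_restrict)
    fix i assume i: "i \<in> {..t}"
    have [measurable]: "(\<lambda>p. p i) \<in> borel_measurable ?P" "(\<lambda>p. p 0) \<in> borel_measurable ?P"
      using i by simp_all
    show "(\<lambda>p. if i = 0 then (p 0 - u) / \<sigma> u else (p i - as i (p 0)) / bs i (p 0)) \<in> borel_measurable ?P"
    proof (cases "i = 0")
      case False
      then have [measurable]: "as i \<in> borel_measurable borel" "bs i \<in> borel_measurable borel"
        using as_meas bs_meas by auto
      show ?thesis using False by simp
    qed simp
  qed
  define Z where "Z u \<omega> = T u (\<lambda>i\<in>{..t}. x u \<omega> i)" for u \<omega>
  have Z_meas: "Z u \<in> W \<rightarrow>\<^sub>M ?P" for u
    unfolding Z_def[abs_def] by (rule measurable_compose[OF x_meas T])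
  have law_Z: "distr (uniform_measure M {\<omega>\<in>space M. X 0 \<omega> > u}) ?P (normalized_chain X \<sigma> as bs t u) = distr W ?P (Z u)" for u
  proof -
    have "normalized_chain X \<sigma> as bs t u = T u \<circ> (\<lambda>\<omega>. \<lambda>i\<in>{..t}. X i \<omega>)"
      by (auto simp: normalized_chain_def T_def fun_eq_iff)
    then have "distr (uniform_measure M {\<omega>\<in>space M. X 0 \<omega> > u}) ?P (normalized_chain X \<sigma> as bs t u) =
      distr (distr (uniform_measure M {\<omega>\<in>space M. X 0 \<omega> > u}) ?P (\<lambda>\<omega>. \<lambda>i\<in>{..t}. X i \<omega>)) ?P (T u)"
      by (subst distr_distr[OF T]) auto
    also have "\<dots> = distr W ?P (Z u)"
      unfolding law_x by (subst distr_distr[OF T x_meas]) (simp add: comp_def Z_def[abs_def])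
    finally show ?thesis .
  qed
  have law_y: "distr N ?P (\<lambda>\<omega>. \<lambda>i\<in>{..t}. if i = 0 then E\<^sub>0 \<omega> else Y i \<omega>) =
    distr W ?P (\<lambda>\<omega>. \<lambda>i\<in>{..t}. y \<omega> i)"
    unfolding W_def y_def by (rule tail_law_eq_driven_path[OF tail_chain K t E0(1) H E0(2) indep \<psi>])

  \<comment> \<open>Almost sure convergence of the quantiles\<close>
  have \<mu>_conv: "((\<lambda>u. quantile (\<mu> u) \<omega>) \<longlongrightarrow> quantile H\<^sub>0 \<omega>) at_top"
    if "0 < \<omega>" "\<omega> < 1" "isCont (quantile H\<^sub>0) \<omega>" for \<omega>
  proof (rule quantile_tendsto[OF \<mu> H _ that])
    have "weak_conv_on euclideanreal \<mu> H\<^sub>0 at_top"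
      by (rule weak_conv_on_subspaceD[where S="{0..}"])
        (use \<mu> \<mu>_nn H H_AE wF in \<open>auto simp: \<mu>_def[abs_def]\<close>)
    from weak_conv_on_cdf_tendsto[OF \<mu> H this]
    show "((\<lambda>u. cdf (\<mu> u) z) \<longlongrightarrow> cdf H\<^sub>0 z) at_top" if "measure H\<^sub>0 {z} = 0" for z
      using that .
  qed
  have \<kappa>_conv: "((\<lambda>v. quantile (\<kappa> v) \<omega>) \<longlongrightarrow> quantile K \<omega>) at_top"
    if "0 < \<omega>" "\<omega> < 1" "isCont (quantile K) \<omega>" for \<omega>
  proof (rule quantile_tendsto[OF \<kappa> K _ that])
    have "weak_conv_on euclideanreal \<kappa> K at_top" using wK by (simp add: \<kappa>_def[abs_def])
    from weak_conv_on_cdf_tendsto[OF \<kappa> K this]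
    show "((\<lambda>v. cdf (\<kappa> v) z) \<longlongrightarrow> cdf K z) at_top" if "measure K {z} = 0" for z
      using that .
  qed
  have W01: "0 < \<omega> i" "\<omega> i < 1" if "\<omega> \<in> space W" "i \<le> t" for \<omega> i
    using that by (auto simp: W_def space_PiM PiE_iff)
  \<comment> \<open>Only finitely many null sets are discarded, and they depend on
    \<open>H\<^sub>0\<close> and \<open>K\<close> alone, hence not on the continuous parameter
    \<open>u\<close>.\<close>
  have good: "AE \<omega> in W. isCont (quantile H\<^sub>0) (\<omega> 0) \<and> (\<forall>i\<in>{..t}. isCont (quantile K) (\<omega> i))"
  proof (intro AE_conjI AE_finite_allI)
    have comp: "AE \<omega> in W. isCont (quantile \<nu>) (\<omega> i)" if "real_distribution \<nu>" "i \<in> {..t}" for \<nu> i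
      unfolding W_def by (rule AE_PiM_component) (use that in \<open>auto intro: prob_space_uniform01 AE_isCont_quantile\<close>)
    show "AE \<omega> in W. isCont (quantile H\<^sub>0) (\<omega> 0)" by (rule comp[OF H]) simp
    show "AE \<omega> in W. isCont (quantile K) (\<omega> i)" if "i \<in> {..t}" for i by (rule comp[OF K that])
  qed simp

  \<comment> \<open>Convergence of the normalised paths in the half-space\<close>
  have x0: "x u \<omega> 0 = u + \<sigma> u * quantile (\<mu> u) (\<omega> 0)" for u \<omega> by (simp add: x_def f_def)
  have x0_ge: "quantile (\<mu> u) (\<omega> 0) \<ge> 0" if "\<omega> \<in> space W" for u \<omega>
    using quantile_nonneg[OF \<mu> \<mu>_nn] W01[OF that, of 0] by simp
  have Z0: "Z u \<omega> 0 = quantile (\<mu> u) (\<omega> 0)" for u \<omega>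
    using \<sigma>[of u] by (simp add: Z_def T_def x0)
  have Z_top: "Z u \<omega> \<in> topspace (half_space t)" if "\<omega> \<in> space W" for u \<omega>
    using x0_ge[OF that, of u] Z0[of u \<omega>] by (auto simp: half_space_def PiE_iff Z_def T_def)
  have y0_ge: "y \<omega> 0 \<ge> 0" if "\<omega> \<in> space W" for \<omega>
    using quantile_nonneg[OF H H_AE] W01[OF that, of 0] by (simp add: y_def)
  have y_top: "(\<lambda>i\<in>{..t}. y \<omega> i) \<in> topspace (half_space t)" if "\<omega> \<in> space W" for \<omega>
    using y0_ge[OF that] by (auto simp: half_space_def PiE_iff)

  have lim: "limitin (half_space t) (\<lambda>u. Z u \<omega>) (\<lambda>i\<in>{..t}. y \<omega> i) at_top"
    if \<omega>: "\<omega> \<in> space W" "isCont (quantile H\<^sub>0) (\<omega> 0)" "\<And>i. i \<le> t \<Longrightarrow> isCont (quantile K) (\<omega> i)" for \<omega>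
    unfolding half_space_def limitin_componentwise
  proof (intro conjI ballI)
    show "\<forall>\<^sub>F u in at_top. Z u \<omega> \<in> topspace (product_topology (\<lambda>i. if i = 0 then top_of_set {0..} else euclideanreal) {..t})"
      using Z_top[OF \<omega>(1)] by (simp add: half_space_def)
    fix i assume i: "i \<in> {..t}"
    show "limitin (if i = 0 then top_of_set {0..} else euclideanreal) (\<lambda>u. Z u \<omega> i) ((\<lambda>i\<in>{..t}. y \<omega> i) i) at_top"
    proof (cases "i = 0")
      case True
      then show ?thesis
        using \<mu>_conv[OF W01[OF \<omega>(1)] \<omega>(2)] x0_ge[OF \<omega>(1)] y0_ge[OF \<omega>(1)]
        by (simp add: limitin_subtopology Z0 y_def)
    next
      case False
      \<comment> \<open>The initial state is \<open>u\<close> plus a nonnegative excess, so it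
        diverges with \<open>u\<close>.\<close>
      have "filterlim (\<lambda>u. x u \<omega> 0) at_top at_top"
        by (rule filterlim_at_top_mono[OF filterlim_ident])
          (use x0_ge[OF \<omega>(1)] \<sigma> in \<open>auto simp: x0 less_imp_le intro!: always_eventually\<close>)
      then have "((\<lambda>u. (x u \<omega> i - as i (x u \<omega> 0)) / bs i (x u \<omega> 0)) \<longlongrightarrow> y \<omega> i) at_top"
      proof (rule normalized_path_tendsto[OF A2a A2b b, where e="\<lambda>s w. quantile (\<kappa> w) (\<omega> s)" and e'="\<lambda>s. quantile K (\<omega> s)"])
        show "((\<lambda>w. quantile (\<kappa> w) (\<omega> s)) \<longlongrightarrow> quantile K (\<omega> s)) at_top" if "s \<le> t" for s
          by (rule \<kappa>_conv[OF W01[OF \<omega>(1) that] \<omega>(3)[OF that]])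
      qed (use i False in \<open>auto simp: x_def q_def y_def tail_step_def\<close>)
      then show ?thesis using i False by (simp add: Z_def T_def)
    qed
  qed simp

  \<comment> \<open>Dominated convergence for bounded continuous test functions\<close>
  show ?thesis
    unfolding weak_conv_on_def law_Z law_y
  proof safe
    fix g :: "(nat \<Rightarrow> real) \<Rightarrow> real"
    assume g: "continuous_map (half_space t) euclideanreal g" and bd: "bounded (g ` topspace (half_space t))"
    \<comment> \<open>The test function is extended by zero, since the laws live on all of the
      product space. The coupled paths and their limit stay in the half-space, where this changes
      nothing.\<close>
    let ?g = "\<lambda>p. indicator (topspace (half_space t)) p *\<^sub>R g p"
    note g_meas [measurable] = half_space_indicator_borel_measurable[OF g]
    from bd obtain B where B: "\<And>p. p \<in> topspace (half_space t) \<Longrightarrow> \<bar>g p\<bar> \<le> B"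
      by (auto simp: bounded_iff)
    have "((\<lambda>u. \<integral>\<omega>. ?g (Z u \<omega>) \<partial>W) \<longlongrightarrow> (\<integral>\<omega>. ?g (\<lambda>i\<in>{..t}. y \<omega> i) \<partial>W)) at_top"
    proof (rule integral_dominated_convergence_at_top[where w="\<lambda>_. B"])
      show "(\<lambda>\<omega>. ?g (\<lambda>i\<in>{..t}. y \<omega> i)) \<in> borel_measurable W" by (rule measurable_compose[OF y_meas g_meas])
      show "(\<lambda>\<omega>. ?g (Z u \<omega>)) \<in> borel_measurable W" for u by (rule measurable_compose[OF Z_meas g_meas])
      show "\<forall>\<^sub>F u in at_top. AE \<omega> in W. norm (?g (Z u \<omega>)) \<le> B"
        using B Z_top by (intro always_eventually allI AE_I2) simp
      show "AE \<omega> in W. ((\<lambda>u. ?g (Z u \<omega>)) \<longlongrightarrow> ?g (\<lambda>i\<in>{..t}. y \<omega> i)) at_top"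
        using good AE_space
      proof eventually_elim
        case (elim \<omega>)
        then have "limitin (half_space t) (\<lambda>u. Z u \<omega>) (\<lambda>i\<in>{..t}. y \<omega> i) at_top" by (intro lim) auto
        from continuous_map_limit[OF g this]
        have "((\<lambda>u. g (Z u \<omega>)) \<longlongrightarrow> g (\<lambda>i\<in>{..t}. y \<omega> i)) at_top" by (simp add: comp_def)
        then show ?case using Z_top y_top elim by simp
      qed
    qed simp
    then show "((\<lambda>u. set_lebesgue_integral (distr W ?P (Z u)) (topspace (half_space t)) g) \<longlongrightarrow>
      set_lebesgue_integral (distr W ?P (\<lambda>\<omega>. \<lambda>i\<in>{..t}. y \<omega> i)) (topspace (half_space t)) g) at_top"
      unfolding set_lebesgue_integral_def
      by (simp only: integral_distr[OF Z_meas g_meas] integral_distr[OF y_meas g_meas])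
  qed
qed

end
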